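(* Let $(S,\mathcal{B})$ be a measurable space, let $X_n$ be the $n$th canonical projection on $(S^\infty,\mathcal{B}^\infty)$, and let $P$ be a probability on $(S^\infty,\mathcal{B}^\infty)$ under which $X=(X_1,X_2,\ldots)$ is conditionally identically distributed (c.i.d.). Let $Q_0$ be a Ferguson–Dirichlet law on $(S^\infty,\mathcal{B}^\infty)$. Suppose $\mathcal{D}\subset\mathcal{B}$ is countably determined and, with $\|\cdot\|$ the sup-norm over $\mathcal{D}$, $\sup_n E_{Q_0}\|W_n\|^2<\infty$. Suppose $P\ll Q_0$ and $$E_{Q_0}(f^2)-E_{Q_0}\{E_{Q_0}(f\mid\mathcal{G}_n)^2\}=O\left(\frac1n\right)$$ for some version $f$ of $\frac{dP}{dQ_0}$ (where $E_{Q_0}(f^2)<\infty$). Then $\sqrt{n}\,\|C_n\|=n\,\|\mu_n-a_n\|$ converges $P$-a.s. as $n\to\infty$.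
   Context: $E$ denotes expectation under $P$ and $E_{Q_0}$ expectation under $Q_0$. $\mathcal{G}_0$ is the trivial $\sigma$-field and $\mathcal{G}_n=\sigma(X_1,\ldots,X_n)$. $X$ is c.i.d. under $P$ if $E(I_B(X_k)\mid\mathcal{G}_n)=E(I_B(X_{n+1})\mid\mathcal{G}_n)$ $P$-a.s. for all $B\in\mathcal{B}$ and $k>n\ge 0$. For $B\in\mathcal{B}$: $\mu_n(B)=\frac1n\sum_{i=1}^n I_B(X_i)$; $a_n(B)=P(X_{n+1}\in B\mid\mathcal{G}_n)$; $\mu(B)=\limsup_n\mu_n(B)$; $W_n(B)=\sqrt{n}\{\mu_n(B)-\mu(B)\}$; $C_n(B)=E(W_n(B)\mid\mathcal{G}_n)=\sqrt{n}\{\mu_n(B)-a_n(B)\}$ $P$-a.s. For a real function $F$ on $\mathcal{D}$, $\|F\|=\sup_{B\in\mathcal{D}}|F(B)|$. $\mathcal{D}\subset\mathcal{B}$ is countably determined if there is a countable subclass $\mathcal{D}_0\subset\mathcal{D}$ such that $\sup_{B\in\mathcal{D}_0}|\nu_1(B)-\nu_2(B)|=\sup_{B\in\mathcal{D}}|\nu_1(B)-\nu_2(B)|$ for every pair $\nu_1,\nu_2$ of probabilities on $\mathcal{B}$. This condition serves to handle measurability: suprema over $\mathcal{D}$ are understood as suprema over such a fixed $\mathcal{D}_0$, so that $\|W_n\|$ and $\|C_n\|$ are random variables (well defined up to null sets). A Ferguson–Dirichlet law on $(S^\infty,\mathcal{B}^\infty)$ is a probability $Q_0$ for which there is a constant $\alpha>0$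 such that, for all $B\in\mathcal{B}$ and $n\ge1$, $$Q_0(X_{n+1}\in B\mid\mathcal{G}_n)=\frac{\alpha\,Q_0(X_1\in B)+n\,\mu_n(B)}{\alpha+n}\quad Q_0\text{-a.s.}$$ Under such a $Q_0$ the sequence $X$ is exchangeable. *)

theory Defs
  imports "HOL-Probability.Probability" "HOL-Library.Landau_Symbols"
begin

text \<open>
  The measure \<open>M\<close> only carries the measurable space $(S, \mathcal{B})$, as
  \<open>space M\<close> and \<open>sets M\<close>. Coordinates of sequences are numbered from \<open>0\<close>: the projection
  $X_{i+1}$ of the mathematical text is \<open>\<lambda>\<omega>. \<omega> i\<close>, so that $X_1, \ldots, X_n$ are the
  coordinates \<open>i < n\<close> and $X_{n+1}$ is \<open>\<lambda>\<omega>. \<omega> n\<close>.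
\<close>

abbreviation seq_space :: "'a measure \<Rightarrow> (nat \<Rightarrow> 'a) measure" where
  "seq_space M \<equiv> PiM UNIV (\<lambda>_. M)"

definition past :: "'a measure \<Rightarrow> nat \<Rightarrow> (nat \<Rightarrow> 'a) measure" where
  "past M n = sigma (space (seq_space M))
     {(\<lambda>\<omega>. \<omega> i) -` B \<inter> space (seq_space M) | i B. i < n \<and> B \<in> sets M}"

definition predictive ::
  "'a measure \<Rightarrow> (nat \<Rightarrow> 'a) measure \<Rightarrow> nat \<Rightarrow> 'a set \<Rightarrow> (nat \<Rightarrow> 'a) \<Rightarrow> real" where
  "predictive M P n B = real_cond_exp P (past M n) (\<lambda>\<omega>. indicator B (\<omega> n))"

text \<open>
  In the mathematical numbering the condition below is for $k > n$; the shift by one turns it into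
  \<open>n \<le> k\<close>.
\<close>

definition cid :: "'a measure \<Rightarrow> (nat \<Rightarrow> 'a) measure \<Rightarrow> bool" where
  "cid M P \<longleftrightarrow> (\<forall>B\<in>sets M. \<forall>n k. n \<le> k \<longrightarrow>
     (AE \<omega> in P. real_cond_exp P (past M n) (\<lambda>\<omega>. indicator B (\<omega> k)) \<omega>
               = real_cond_exp P (past M n) (\<lambda>\<omega>. indicator B (\<omega> n)) \<omega>))"

definition empirical :: "nat \<Rightarrow> 'a set \<Rightarrow> (nat \<Rightarrow> 'a) \<Rightarrow> real" where
  "empirical n B \<omega> = (\<Sum>i<n. indicator B (\<omega> i)) / real n"

definition limit_empirical :: "'a set \<Rightarrow> (nat \<Rightarrow> 'a) \<Rightarrow> real" where
  "limit_empirical B \<omega> = real_of_ereal (limsup (\<lambda>n. ereal (empirical n B \<omega>)))"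

definition W :: "nat \<Rightarrow> 'a set \<Rightarrow> (nat \<Rightarrow> 'a) \<Rightarrow> real" where
  "W n B \<omega> = sqrt (real n) * (empirical n B \<omega> - limit_empirical B \<omega>)"

definition C ::
  "'a measure \<Rightarrow> (nat \<Rightarrow> 'a) measure \<Rightarrow> nat \<Rightarrow> 'a set \<Rightarrow> (nat \<Rightarrow> 'a) \<Rightarrow> real" where
  "C M P n B = real_cond_exp P (past M n) (W n B)"

text \<open>
  The sup-norm takes values in \<^typ>\<open>ennreal\<close>, so that it is also meaningful for unbounded functions
  (versions of conditional expectations may be unbounded in \<open>B\<close> on a null set) and is \<open>0\<close> over the
  empty class.
\<close>

definition sup_norm :: "'a set set \<Rightarrow> ('a set \<Rightarrow> real) \<Rightarrow> ennreal" where
  "sup_norm D F = (SUP B\<in>D. ennreal \<bar>F B\<bar>)"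

text \<open>
  The class \<open>D\<close> is countably determined, with \<open>D0\<close> as witnessing countable subclass. Suprema of
  random variables over \<open>D\<close> are to be taken over \<open>D0\<close>, which makes them measurable and independent
  (up to null sets) of the chosen versions of conditional expectations.
\<close>

definition countably_determined_by :: "'a measure \<Rightarrow> 'a set set \<Rightarrow> 'a set set \<Rightarrow> bool" where
  "countably_determined_by M D D0 \<longleftrightarrow>
     countable D0 \<and> D0 \<subseteq> D \<and>
     (\<forall>\<nu>1 \<nu>2. prob_space \<nu>1 \<and> sets \<nu>1 = sets M \<and> prob_space \<nu>2 \<and> sets \<nu>2 = sets M \<longrightarrow>
        sup_norm D0 (\<lambda>B. measure \<nu>1 B - measure \<nu>2 B)
        = sup_norm D (\<lambda>B. measure \<nu>1 B - measure \<nu>2 B))"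

definition ferguson_dirichlet :: "'a measure \<Rightarrow> (nat \<Rightarrow> 'a) measure \<Rightarrow> bool" where
  "ferguson_dirichlet M Q \<longleftrightarrow>
     prob_space Q \<and> sets Q = sets (seq_space M) \<and>
     (\<exists>\<alpha>>0. \<forall>B\<in>sets M. \<forall>n\<ge>1. AE \<omega> in Q.
        predictive M Q n B \<omega>
        = (\<alpha> * measure Q {\<omega> \<in> space Q. \<omega> 0 \<in> B} + real n * empirical n B \<omega>) / (\<alpha> + real n))"

end

theory Submission
  imports Defs
begin

text \<open>
  Write \<open>Z\<^sub>n(B) = n (\<mu>\<^sub>n(B) - a\<^sub>n(B))\<close>, where \<open>\<mu>\<^sub>n\<close> is the empirical and \<open>a\<^sub>n\<close> the predictive measure
  under \<open>P\<close>. Since \<open>P\<close> is c.i.d., \<open>a\<^sub>n(B)\<close> is a martingale, and then so is \<open>Z\<^sub>n(B)\<close>: its increment is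
  \<open>(I\<^sub>B(X\<^sub>n\<^sub>+\<^sub>1) - a\<^sub>n(B)) - (n + 1) (a\<^sub>n\<^sub>+\<^sub>1(B) - a\<^sub>n(B))\<close>. The supremum of \<open>\<bar>Z\<^sub>n(B)\<bar>\<close>
  over countably many \<open>B\<close> is therefore a nonnegative submartingale (\<open>sup_gap_submartingale\<close>), and by Doob's theorem
  (\<open>bounded_submartingale.AE_convergent\<close>, proved by counting upcrossings) it converges almost surely
  to a finite limit as soon as its expectations under \<open>P\<close> are bounded.

  The bound comes from a comparison with \<open>Q\<close>, the Ferguson-Dirichlet law. Let \<open>f\<close> be the density of
  \<open>P\<close> and \<open>f\<^sub>n\<close> its conditional expectation given the first \<open>n\<close> coordinates. As
  \<open>Z\<^sub>n(B) = \<surd>n E\<^sub>P(W\<^sub>n(B) | G\<^sub>n)\<close>, the Bayes formula (\<open>bayes\<close>) gives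
  \<open>f\<^sub>n Z\<^sub>n(B) = \<surd>n E\<^sub>Q((f - f\<^sub>n) W\<^sub>n(B) | G\<^sub>n) + f\<^sub>n \<surd>n E\<^sub>Q(W\<^sub>n(B) | G\<^sub>n)\<close>.
  The explicit predictive rule of \<open>Q\<close> shows that \<open>\<surd>n \<bar>E\<^sub>Q(W\<^sub>n(B) | G\<^sub>n)\<bar> \<le> \<alpha>\<close> (\<open>cond_exp_W_bound\<close>). In
  the first summand, \<open>2 \<surd>n \<bar>f - f\<^sub>n\<bar> \<bar>W\<^sub>n(B)\<bar> \<le> n (f - f\<^sub>n)\<^sup>2 + \<parallel>W\<^sub>n\<parallel>\<^sup>2\<close>, a majorant that does not depend on
  \<open>B\<close> (\<open>lik_gap_le\<close>). Taking the supremum over \<open>B\<close> and integrating (\<open>expectation_sup_gap_le\<close>), the two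
  terms of the majorant are bounded by the two quantitative hypotheses, because
  \<open>E\<^sub>Q (f - f\<^sub>n)\<^sup>2 = E\<^sub>Q f\<^sup>2 - E\<^sub>Q f\<^sub>n\<^sup>2\<close>.

  The identity between \<open>\<surd>n C\<^sub>n\<close> and \<open>Z\<^sub>n\<close> needs that \<open>\<mu>\<^sub>n(B)\<close> converges almost surely. Under \<open>Q\<close> the
  predictive probabilities are a bounded martingale and differ from \<open>\<mu>\<^sub>n(B)\<close> by \<open>O(1/n)\<close>, so this is
  again Doob's theorem (\<open>AE_convergent_empirical\<close>); absolute continuity carries it over to \<open>P\<close>.
\<close>

section \<open>Almost sure convergence of bounded nonnegative submartingales\<close>

text \<open>
  Whether a unit of \<open>x\<close> is held between times \<open>n\<close> and \<open>n + 1\<close> under the strategy "buy when \<open>x \<le> a\<close>,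
  sell when \<open>x \<ge> b\<close>". It depends on \<open>x 0, \<dots>, x n\<close> only, which makes it predictable.
\<close>

primrec holding :: "real \<Rightarrow> real \<Rightarrow> (nat \<Rightarrow> real) \<Rightarrow> nat \<Rightarrow> bool" where
  "holding a b x 0 \<longleftrightarrow> x 0 \<le> a"
| "holding a b x (Suc n) \<longleftrightarrow> x (Suc n) \<le> a \<or> (x (Suc n) < b \<and> holding a b x n)"

text \<open>
  Every completed upcrossing earns at least \<open>b - a\<close>. The strategy is played on the positive part
  \<open>(x - a)\<^sup>+\<close>, which vanishes at each purchase, so that an unfinished holding period never ends in a
  loss; its gain so far, \<open>y n\<close>, is kept as a term on the left to make the induction go through.
\<close>

lemma upcrossing_gain:
  fixes x :: "nat \<Rightarrow> real"
  assumes "a < b"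
  defines "y \<equiv> \<lambda>k. max 0 (x k - a)"
  shows "(b - a) * (\<Sum>k<n. of_bool (holding a b x k \<and> b \<le> x (Suc k)))
    + of_bool (holding a b x n) * y n
    \<le> (\<Sum>k<n. of_bool (holding a b x k) * (y (Suc k) - y k))"
proof (induction n)
  case 0
  then show ?case by (simp add: y_def)
next
  case (Suc n)
  show ?case
  proof (cases "holding a b x n")
    case True
    have "(b - a) * of_bool (b \<le> x (Suc n)) + of_bool (holding a b x (Suc n)) * y (Suc n) \<le> y (Suc n)"
      using True \<open>a < b\<close> by (auto simp: y_def)
    with Suc True show ?thesis by (simp add: algebra_simps)
  next
    case False
    then have "of_bool (holding a b x (Suc n)) * y (Suc n) = 0"
      by (auto simp: y_def)
    with Suc False show ?thesis by (simp del: holding.simps)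
  qed
qed

text \<open>
  After the last completed upcrossing, the next purchase is never followed by a sale, so the position
  is held forever and \<open>x\<close> stays below \<open>b\<close>.
\<close>

lemma finitely_many_upcrossings:
  fixes x :: "nat \<Rightarrow> real"
  assumes "eventually (\<lambda>k. \<not> (holding a b x k \<and> b \<le> x (Suc k))) sequentially"
    and low: "frequently (\<lambda>k. x k \<le> a) sequentially"
  shows "eventually (\<lambda>k. x k < b) sequentially"
proof -
  obtain k0 where k0: "\<And>k. k \<ge> k0 \<Longrightarrow> holding a b x k \<Longrightarrow> x (Suc k) < b"
    using assms(1) unfolding eventually_sequentially by (meson not_le)
  obtain m where m: "m \<ge> k0" "x m \<le> a"
    using low unfolding frequently_sequentially by blast
  have hold: "holding a b x k" if "m \<le> k" for k
    using that
  proof (induction k rule: dec_induct)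
    case base
    then show ?case using m by (cases m) auto
  next
    case (step k)
    then show ?case using k0[of k] m by auto
  qed
  have "x k < b" if "Suc m \<le> k" for k
    using k0[of "k - 1"] hold[of "k - 1"] that m by (cases k) auto
  then show ?thesis unfolding eventually_sequentially by blast
qed

text \<open>
  A sequence with \<open>liminf < limsup\<close> oscillates between two rational levels. Countably many levels
  suffice, which is what allows exchanging this criterion with "almost everywhere".
\<close>

lemma tendsto_of_no_oscillation:
  fixes u :: "nat \<Rightarrow> ennreal"
  assumes "\<And>r s :: rat. r < s \<Longrightarrow> 0 \<le> r \<Longrightarrow> frequently (\<lambda>n. u n \<le> ennreal (real_of_rat r)) sequentially
    \<Longrightarrow> eventually (\<lambda>n. u n < ennreal (real_of_rat s)) sequentially"
  shows "u \<longlonglongrightarrow> liminf u"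
proof -
  have "limsup u \<le> liminf u"
  proof (rule ccontr)
    assume "\<not> limsup u \<le> liminf u"
    then have "liminf u < limsup u" by simp
    then obtain r' :: rat where r': "liminf u < real_of_rat r'" "real_of_rat r' < limsup u"
      using ennreal_rat_dense by blast
    obtain s :: rat where s: "real_of_rat r' < ennreal (real_of_rat s)" "real_of_rat s < limsup u"
      using ennreal_rat_dense[OF r'(2)] by blast
    define r where "r = max 0 r'"
    have r_eq: "ennreal (real_of_rat r) = ennreal (real_of_rat r')"
      by (auto simp: r_def max_def ennreal_neg)
    have "real_of_rat r' < real_of_rat s" using s(1)
      by (metis ennreal_leI not_le)
    moreover have "0 < real_of_rat s"
      using s(1) by (metis ennreal_eq_0_iff not_gr_zero not_le_imp_less not_less_zero)
    ultimately have rs: "r < s" "0 \<le> r"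
      by (auto simp: r_def of_rat_less)
    have "frequently (\<lambda>n. u n \<le> ennreal (real_of_rat r)) sequentially"
    proof (rule ccontr)
      assume "\<not> ?thesis"
      then have "eventually (\<lambda>n. ennreal (real_of_rat r) \<le> u n) sequentially"
        by (auto simp: not_frequently elim: eventually_mono)
      from Liminf_bounded[OF this] r' r_eq show False by simp
    qed
    from assms[OF rs this] have "eventually (\<lambda>n. u n \<le> ennreal (real_of_rat s)) sequentially"
      by (auto elim: eventually_mono)
    from Limsup_bounded[OF this] s show False by simp
  qed
  then have "limsup u = liminf u"
    by (simp add: Liminf_le_Limsup antisym)
  then show ?thesis
    by (simp add: tendsto_iff_Liminf_eq_Limsup)
qed

text \<open>
  The submartingale property is stated through integrals over past events, which is the form in
  which stopping and switching arguments use it.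
\<close>

locale bounded_submartingale = prob_space M for M :: "'a measure" +
  fixes F :: "nat \<Rightarrow> 'a measure" and X :: "nat \<Rightarrow> 'a \<Rightarrow> real" and K :: real
  assumes subalg: "subalgebra M (F n)"
    and mono: "sets (F n) \<subseteq> sets (F (Suc n))"
    and adapted: "X n \<in> borel_measurable (F n)"
    and integrable: "integrable M (X n)"
    and nonneg: "0 \<le> X n \<omega>"
    and submart: "A \<in> sets (F n) \<Longrightarrow> (\<integral>\<omega>\<in>A. X n \<omega> \<partial>M) \<le> (\<integral>\<omega>\<in>A. X (Suc n) \<omega> \<partial>M)"
    and bounded: "(\<integral>\<omega>. X n \<omega> \<partial>M) \<le> K"
begin

lemma space_F: "space (F n) = space M"
  using subalg by (simp add: subalgebra_def)

lemma sets_F: "A \<in> sets (F n) \<Longrightarrow> A \<in> sets M"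
  using subalg by (auto simp: subalgebra_def)

lemma measurable_X [measurable]: "X n \<in> borel_measurable M"
  using measurable_from_subalg[OF subalg adapted] .

lemma set_integrable: "integrable M g \<Longrightarrow> A \<in> sets M \<Longrightarrow> set_integrable M A g" for g :: "'a \<Rightarrow> real"
  unfolding set_integrable_def by (rule integrable_mult_indicator)

text \<open>
  The positive part \<open>(X - a)\<^sup>+\<close> is again a submartingale: on the past event \<open>X n > a\<close> it equals
  \<open>X n - a\<close>, and elsewhere it is \<open>0\<close>.
\<close>

lemma positive_part:
  assumes A: "A \<in> sets (F n)"
  shows "(\<integral>\<omega>\<in>A. max 0 (X n \<omega> - a) \<partial>M) \<le> (\<integral>\<omega>\<in>A. max 0 (X (Suc n) \<omega> - a) \<partial>M)"
proof -
  define B where "B = {\<omega> \<in> space (F n). a < X n \<omega>} \<inter> A"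
  have B: "B \<in> sets (F n)"
    using A adapted[of n] unfolding B_def by measurable
  have [measurable]: "A \<in> sets M" "B \<in> sets M"
    using sets_F[OF A] sets_F[OF B] .
  have "B \<subseteq> A" by (auto simp: B_def)
  have int: "integrable M (\<lambda>\<omega>. X k \<omega> - a)" "integrable M (\<lambda>\<omega>. max 0 (X k \<omega> - a))" for k
    using integrable[of k] by auto
  have "(\<integral>\<omega>\<in>A. max 0 (X n \<omega> - a) \<partial>M) = (\<integral>\<omega>\<in>B. (X n \<omega> - a) \<partial>M)"
    unfolding set_lebesgue_integral_def using sets.sets_into_space[OF \<open>A \<in> sets M\<close>]
    by (intro Bochner_Integration.integral_cong)
       (auto simp: B_def space_F indicator_def)
  also have "\<dots> = (\<integral>\<omega>\<in>B. X n \<omega> \<partial>M) - (\<integral>\<omega>\<in>B. a \<partial>M)"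
    by (intro set_integral_diff set_integrable integrable) auto
  also have "\<dots> \<le> (\<integral>\<omega>\<in>B. X (Suc n) \<omega> \<partial>M) - (\<integral>\<omega>\<in>B. a \<partial>M)"
    using submart[OF B] by simp
  also have "\<dots> = (\<integral>\<omega>\<in>B. (X (Suc n) \<omega> - a) \<partial>M)"
    by (intro set_integral_diff(2)[symmetric] set_integrable integrable) auto
  also have "\<dots> \<le> (\<integral>\<omega>\<in>A. max 0 (X (Suc n) \<omega> - a) \<partial>M)"
    unfolding set_lebesgue_integral_def
  proof (rule integral_mono)
    show "integrable M (\<lambda>\<omega>. indicator B \<omega> *\<^sub>R (X (Suc n) \<omega> - a))"
      by (rule integrable_mult_indicator[OF \<open>B \<in> sets M\<close> int(1)])
    show "integrable M (\<lambda>\<omega>. indicator A \<omega> *\<^sub>R max 0 (X (Suc n) \<omega> - a))"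
      by (rule integrable_mult_indicator[OF \<open>A \<in> sets M\<close> int(2)])
    show "indicator B \<omega> *\<^sub>R (X (Suc n) \<omega> - a) \<le> indicator A \<omega> *\<^sub>R max 0 (X (Suc n) \<omega> - a)" for \<omega>
      using \<open>B \<subseteq> A\<close> by (auto simp: indicator_def)
  qed
  finally show ?thesis .
qed

lemma holding_measurable: "Measurable.pred (F n) (\<lambda>\<omega>. holding a b (\<lambda>k. X k \<omega>) n)"
proof (induction n)
  case 0
  then show ?case using adapted[of 0] by simp
next
  case (Suc n)
  have "subalgebra (F (Suc n)) (F n)"
    using mono by (simp add: subalgebra_def space_F)
  from measurable_from_subalg[OF this Suc] have [measurable]:
    "Measurable.pred (F (Suc n)) (\<lambda>\<omega>. holding a b (\<lambda>k. X k \<omega>) n)" .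
  note adapted[of "Suc n", measurable]
  show ?case by simp
qed

lemma holding_measurable' [measurable]: "Measurable.pred M (\<lambda>\<omega>. holding a b (\<lambda>k. X k \<omega>) n)"
  by (rule measurable_from_subalg[OF subalg holding_measurable])

definition upcross :: "real \<Rightarrow> real \<Rightarrow> nat \<Rightarrow> 'a set" where
  "upcross a b k = {\<omega> \<in> space M. holding a b (\<lambda>k. X k \<omega>) k \<and> b \<le> X (Suc k) \<omega>}"

lemma upcross_sets [measurable]: "upcross a b k \<in> sets M"
  unfolding upcross_def by measurable

text \<open>
  Doob's upcrossing inequality. Playing the strategy earns on average at most as much as holding all
  the time, since the omitted increments lie on past events and have nonnegative mean.
\<close>

lemma upcrossing_inequality:
  assumes "a < b"
  shows "(b - a) * (\<Sum>k<n. prob (upcross a b k)) \<le> K + \<bar>a\<bar>"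
proof -
  define Y where "Y = (\<lambda>k \<omega>. max 0 (X k \<omega> - a))"
  define H where "H = (\<lambda>k \<omega>. of_bool (holding a b (\<lambda>k. X k \<omega>) k) :: real)"
  have intY: "integrable M (Y k)" for k
    unfolding Y_def using integrable[of k] by auto
  have Hm [measurable]: "H k \<in> borel_measurable M" for k
    unfolding H_def by measurable
  have intHY: "integrable M (\<lambda>\<omega>. H k \<omega> * Y j \<omega>)" for k j
    by (rule Bochner_Integration.integrable_bound[OF intY[of j]])
       (use intY[of j] in \<open>auto simp: H_def\<close>)
  have intG: "integrable M (\<lambda>\<omega>. H k \<omega> * (Y (Suc k) \<omega> - Y k \<omega>))" for k
    unfolding right_diff_distrib by (rule Bochner_Integration.integrable_diff[OF intHY intHY])
  have gain: "(\<integral>\<omega>. H k \<omega> * (Y (Suc k) \<omega> - Y k \<omega>) \<partial>M) \<le> (\<integral>\<omega>. Y (Suc k) \<omega> \<partial>M) - (\<integral>\<omega>. Y k \<omega> \<partial>M)" for k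
  proof -
    \<comment> \<open>the past event on which the strategy skips the increment\<close>
    define A where "A = {\<omega> \<in> space (F k). \<not> holding a b (\<lambda>k. X k \<omega>) k}"
    have A: "A \<in> sets (F k)"
      using holding_measurable[of a b k] unfolding A_def by measurable
    have eq: "(\<integral>\<omega>\<in>A. Y j \<omega> \<partial>M) = (\<integral>\<omega>. Y j \<omega> \<partial>M) - (\<integral>\<omega>. H k \<omega> * Y j \<omega> \<partial>M)" for j
      unfolding set_lebesgue_integral_def
      by (subst Bochner_Integration.integral_diff[OF intY intHY, symmetric],
          intro Bochner_Integration.integral_cong)
         (auto simp: A_def H_def space_F)
    have "(\<integral>\<omega>. H k \<omega> * (Y (Suc k) \<omega> - Y k \<omega>) \<partial>M)
        = (\<integral>\<omega>. H k \<omega> * Y (Suc k) \<omega> \<partial>M) - (\<integral>\<omega>. H k \<omega> * Y k \<omega> \<partial>M)"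
      using intHY by (simp add: right_diff_distrib)
    with positive_part[OF A, of a] eq[of k] eq[of "Suc k"] show ?thesis
      by (simp add: Y_def)
  qed
  have intU: "integrable M (indicator (upcross a b k) :: 'a \<Rightarrow> real)" for k
    by (rule integrable_real_indicator) (auto simp: less_top[symmetric])
  have "(b - a) * (\<Sum>k<n. prob (upcross a b k))
      = (\<integral>\<omega>. (b - a) * (\<Sum>k<n. indicator (upcross a b k) \<omega>) \<partial>M)"
    by (subst integral_mult_right_zero, subst Bochner_Integration.integral_sum[OF intU]) simp
  also have "\<dots> \<le> (\<integral>\<omega>. (\<Sum>k<n. H k \<omega> * (Y (Suc k) \<omega> - Y k \<omega>)) \<partial>M)"
  proof (rule integral_mono)
    show "integrable M (\<lambda>\<omega>. (b - a) * (\<Sum>k<n. indicator (upcross a b k) \<omega>))"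
      by (intro integrable_mult_right Bochner_Integration.integrable_sum intU)
    show "integrable M (\<lambda>\<omega>. \<Sum>k<n. H k \<omega> * (Y (Suc k) \<omega> - Y k \<omega>))"
      by (intro Bochner_Integration.integrable_sum intG)
    fix \<omega> assume "\<omega> \<in> space M"
    then have "(\<Sum>k<n. indicator (upcross a b k) \<omega> :: real)
      = (\<Sum>k<n. of_bool (holding a b (\<lambda>k. X k \<omega>) k \<and> b \<le> X (Suc k) \<omega>))"
      by (intro sum.cong) (auto simp: upcross_def indicator_def)
    then have "(b - a) * (\<Sum>k<n. indicator (upcross a b k) \<omega>)
      = (b - a) * (\<Sum>k<n. of_bool (holding a b (\<lambda>k. X k \<omega>) k \<and> b \<le> X (Suc k) \<omega>))"
      by (rule arg_cong)
    moreover have "0 \<le> of_bool (holding a b (\<lambda>k. X k \<omega>) n) * max 0 (X n \<omega> - a)"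
      by simp
    ultimately show "(b - a) * (\<Sum>k<n. indicator (upcross a b k) \<omega>)
       \<le> (\<Sum>k<n. H k \<omega> * (Y (Suc k) \<omega> - Y k \<omega>))"
      using upcrossing_gain[OF assms, of "\<lambda>k. X k \<omega>" n] unfolding H_def Y_def by linarith
  qed
  also have "\<dots> = (\<Sum>k<n. \<integral>\<omega>. H k \<omega> * (Y (Suc k) \<omega> - Y k \<omega>) \<partial>M)"
    by (rule Bochner_Integration.integral_sum[OF intG])
  also have "\<dots> \<le> (\<Sum>k<n. (\<integral>\<omega>. Y (Suc k) \<omega> \<partial>M) - (\<integral>\<omega>. Y k \<omega> \<partial>M))"
    by (intro sum_mono gain)
  also have "\<dots> = (\<integral>\<omega>. Y n \<omega> \<partial>M) - (\<integral>\<omega>. Y 0 \<omega> \<partial>M)"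
    by (rule sum_lessThan_telescope)
  also have "\<dots> \<le> (\<integral>\<omega>. Y n \<omega> \<partial>M)"
    by (simp add: Y_def)
  also have "\<dots> \<le> (\<integral>\<omega>. X n \<omega> + \<bar>a\<bar> \<partial>M)"
  proof (rule integral_mono)
    show "integrable M (\<lambda>\<omega>. X n \<omega> + \<bar>a\<bar>)"
      by (intro Bochner_Integration.integrable_add integrable integrable_const)
    show "Y n \<omega> \<le> X n \<omega> + \<bar>a\<bar>" for \<omega>
      using nonneg[of n \<omega>] unfolding Y_def by linarith
  qed (rule intY)
  also have "\<dots> \<le> K + \<bar>a\<bar>"
    using integrable[of n] bounded[of n] by (simp add: prob_space)
  finally show ?thesis .
qed

lemma AE_finitely_many_upcrossings:
  assumes "a < b"
  shows "AE \<omega> in M. eventually (\<lambda>k. \<not> (holding a b (\<lambda>k. X k \<omega>) k \<and> b \<le> X (Suc k) \<omega>)) sequentially"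
proof -
  have "(\<Sum>k<n. prob (upcross a b k)) \<le> (K + \<bar>a\<bar>) / (b - a)" for n
    using upcrossing_inequality[OF assms, of n] assms by (simp add: field_simps)
  then have "summable (\<lambda>k. prob (upcross a b k))"
    by (intro summableI_nonneg_bounded[where x = "(K + \<bar>a\<bar>) / (b - a)"]) auto
  then have "AE \<omega> in M. eventually (\<lambda>k. \<omega> \<in> space M - upcross a b k) sequentially"
    by (intro borel_cantelli_AE1) (auto simp: less_top[symmetric])
  then show ?thesis
  proof eventually_elim
    case (elim \<omega>)
    then show ?case by (rule eventually_mono) (auto simp: upcross_def)
  qed
qed

text \<open>
  Almost surely no pair of rational levels is crossed infinitely often, by the Borel-Cantelli lemma
  and the upcrossing inequality; the limit is finite by Fatou's lemma.
\<close>

theorem AE_convergent: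
  "AE \<omega> in M. \<exists>l<\<infinity>. (\<lambda>n. ennreal (X n \<omega>)) \<longlonglongrightarrow> l"
proof -
  have "(\<integral>\<^sup>+\<omega>. liminf (\<lambda>n. ennreal (X n \<omega>)) \<partial>M) \<le> liminf (\<lambda>n. \<integral>\<^sup>+\<omega>. ennreal (X n \<omega>) \<partial>M)"
    by (rule nn_integral_liminf) auto
  also have "\<dots> \<le> liminf (\<lambda>n::nat. ennreal K)"
    by (intro Liminf_mono always_eventually allI)
       (auto simp: nn_integral_eq_integral integrable nonneg bounded intro!: ennreal_leI)
  also have "\<dots> = ennreal K" by (simp add: Liminf_const)
  finally have "(\<integral>\<^sup>+\<omega>. liminf (\<lambda>n. ennreal (X n \<omega>)) \<partial>M) \<noteq> \<infinity>"
    by (auto simp: top_unique)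
  then have fin: "AE \<omega> in M. liminf (\<lambda>n. ennreal (X n \<omega>)) \<noteq> \<infinity>"
    by (intro nn_integral_PInf_AE) auto
  have "AE \<omega> in M. \<forall>r s :: rat. r < s \<longrightarrow>
      eventually (\<lambda>k. \<not> (holding (of_rat r) (of_rat s) (\<lambda>k. X k \<omega>) k \<and> of_rat s \<le> X (Suc k) \<omega>)) sequentially"
  proof (subst AE_all_countable, intro allI, subst AE_all_countable, intro allI)
    fix r s :: rat
    show "AE \<omega> in M. r < s \<longrightarrow>
      eventually (\<lambda>k. \<not> (holding (of_rat r) (of_rat s) (\<lambda>k. X k \<omega>) k \<and> of_rat s \<le> X (Suc k) \<omega>)) sequentially"
    proof (cases "r < s")
      case True
      then have "real_of_rat r < real_of_rat s" by (simp add: of_rat_less)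
      from AE_finitely_many_upcrossings[OF this] show ?thesis
        by (rule eventually_mono) blast
    next
      case False
      then show ?thesis by simp
    qed
  qed
  with fin show ?thesis
  proof eventually_elim
    case (elim \<omega>)
    have "(\<lambda>n. ennreal (X n \<omega>)) \<longlonglongrightarrow> liminf (\<lambda>n. ennreal (X n \<omega>))"
    proof (rule tendsto_of_no_oscillation)
      fix r s :: rat
      assume rs: "r < s" "0 \<le> r"
        and fr: "frequently (\<lambda>n. ennreal (X n \<omega>) \<le> ennreal (real_of_rat r)) sequentially"
      have "frequently (\<lambda>n. X n \<omega> \<le> real_of_rat r) sequentially"
        using fr rs by simp
      then have "eventually (\<lambda>n. X n \<omega> < real_of_rat s) sequentially"
        using elim(2) rs finitely_many_upcrossings[of "of_rat r" "of_rat s" "\<lambda>n. X n \<omega>"] by blast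
      then show "eventually (\<lambda>n. ennreal (X n \<omega>) < ennreal (real_of_rat s)) sequentially"
        by (rule eventually_mono) (simp add: ennreal_less_iff nonneg)
    qed
    with elim(1) show ?case
      by (intro exI[of _ "liminf (\<lambda>n. ennreal (X n \<omega>))"]) (auto simp: less_top)
  qed
qed

end

section \<open>Sequence spaces and empirical measures\<close>

lemma past_generators_subset:
  "{(\<lambda>\<omega>. \<omega> i) -` B \<inter> space (seq_space M) | i B. i < n \<and> B \<in> sets M} \<subseteq> Pow (space (seq_space M))"
  by auto

lemma space_past: "space (past M n) = space (seq_space M)"
  unfolding past_def by (rule space_measure_of[OF past_generators_subset])

lemma sets_past:
  "sets (past M n) = sigma_sets (space (seq_space M))
     {(\<lambda>\<omega>. \<omega> i) -` B \<inter> space (seq_space M) | i B. i < n \<and> B \<in> sets M}"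
  unfolding past_def by (rule sets_measure_of[OF past_generators_subset])

lemma coordinate_measurable_past: "i < n \<Longrightarrow> (\<lambda>\<omega>. \<omega> i) \<in> measurable (past M n) M"
proof (rule measurableI)
  fix \<omega> assume "i < n" "\<omega> \<in> space (past M n)"
  then show "\<omega> i \<in> space M" by (auto simp: space_past space_PiM)
next
  fix B assume "i < n" "B \<in> sets M"
  then show "(\<lambda>\<omega>. \<omega> i) -` B \<inter> space (past M n) \<in> sets (past M n)"
    unfolding space_past sets_past by (intro sigma_sets.Basic) blast
qed

lemma subalgebra_past: "subalgebra (seq_space M) (past M n)"
proof -
  have "sets (past M n) \<subseteq> sets (seq_space M)"
    unfolding sets_past
  proof (rule sets.sigma_sets_subset, safe)
    fix i B assume [measurable]: "B \<in> sets M"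
    show "(\<lambda>\<omega>. \<omega> i) -` B \<inter> space (seq_space M) \<in> sets (seq_space M)"
      by measurable
  qed
  then show ?thesis by (simp add: subalgebra_def space_past)
qed

lemma past_mono: "n \<le> m \<Longrightarrow> subalgebra (past M m) (past M n)"
  unfolding subalgebra_def space_past sets_past
  by (intro conjI refl sigma_sets_mono') (auto intro: less_le_trans)

lemma empirical_measurable_past:
  assumes "B \<in> sets M"
  shows "empirical n B \<in> borel_measurable (past M n)"
  unfolding empirical_def[abs_def]
  using measurable_compose[OF coordinate_measurable_past borel_measurable_indicator[OF assms]]
  by (intro borel_measurable_divide borel_measurable_sum borel_measurable_const) auto

lemma empirical_nonneg: "0 \<le> empirical n B \<omega>"
  by (simp add: empirical_def sum_nonneg)

lemma empirical_le_1: "empirical n B \<omega> \<le> 1"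
proof -
  have "(\<Sum>i<n. indicator B (\<omega> i) :: real) \<le> (\<Sum>i<n. 1)"
    by (intro sum_mono) (simp add: indicator_def)
  then show ?thesis by (cases "n = 0") (simp_all add: empirical_def)
qed

lemma empirical_Suc:
  "real (Suc n) * empirical (Suc n) B \<omega> = real n * empirical n B \<omega> + indicator B (\<omega> n)"
  by (cases "n = 0") (simp_all add: empirical_def)

lemma limit_empirical_bounds: "0 \<le> limit_empirical B \<omega>" "limit_empirical B \<omega> \<le> 1"
proof -
  let ?L = "limsup (\<lambda>n. ereal (empirical n B \<omega>))"
  have "?L \<le> 1"
    by (intro Limsup_bounded always_eventually) (simp add: empirical_le_1)
  moreover have "0 \<le> ?L"
    by (intro le_Limsup always_eventually) (simp_all add: empirical_nonneg)
  ultimately show "0 \<le> limit_empirical B \<omega>" "limit_empirical B \<omega> \<le> 1"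
    unfolding limit_empirical_def by (cases ?L; simp)+
qed

lemma empirical_tendsto_limit:
  assumes "convergent (\<lambda>n. empirical n B \<omega>)"
  shows "(\<lambda>n. empirical n B \<omega>) \<longlonglongrightarrow> limit_empirical B \<omega>"
proof -
  obtain l where l: "(\<lambda>n. empirical n B \<omega>) \<longlonglongrightarrow> l"
    using assms by (auto simp: convergent_def)
  then have "(\<lambda>n. ereal (empirical n B \<omega>)) \<longlonglongrightarrow> ereal l" by simp
  then have "limsup (\<lambda>n. ereal (empirical n B \<omega>)) = ereal l"
    by (rule lim_imp_Limsup[rotated]) simp
  with l show ?thesis by (simp add: limit_empirical_def)
qed

lemma W_abs_le: "\<bar>W n B \<omega>\<bar> \<le> sqrt (real n)"
proof -
  have "\<bar>empirical n B \<omega> - limit_empirical B \<omega>\<bar> \<le> 1"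
    using empirical_nonneg[of n B \<omega>] empirical_le_1[of n B \<omega>] limit_empirical_bounds[of B \<omega>]
    by linarith
  then show ?thesis
    unfolding W_def abs_mult using mult_left_mono[of _ 1 "sqrt (real n)"] by simp
qed

locale coordinate_process = prob_space Q
  for M :: "'a measure" and Q :: "(nat \<Rightarrow> 'a) measure" +
  assumes sets_Q: "sets Q = sets (seq_space M)"
begin

lemma space_Q: "space Q = space (seq_space M)"
  using sets_Q by (rule sets_eq_imp_space_eq)

lemma subalgebra_Q: "subalgebra Q (past M n)"
  using subalgebra_past[of M n] by (simp add: subalgebra_def sets_Q space_Q)

sublocale past: finite_measure_subalgebra Q "past M n" for n
  by (intro finite_measure_subalgebra.intro finite_measure_subalgebra_axioms.intro
      subalgebra_Q finite_measure_axioms)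

lemma measurable_from_past: "g \<in> measurable (past M n) N \<Longrightarrow> g \<in> measurable Q N"
  by (rule measurable_from_subalg[OF subalgebra_Q])

lemma sets_from_past: "A \<in> sets (past M n) \<Longrightarrow> A \<in> sets Q"
  using subalgebra_Q by (auto simp: subalgebra_def)

lemma measurable_coordinate [measurable]: "(\<lambda>\<omega>. \<omega> k) \<in> measurable Q M"
  by (rule measurable_from_past[OF coordinate_measurable_past[of k "Suc k"]]) simp

lemma measurable_empirical [measurable]: "B \<in> sets M \<Longrightarrow> empirical n B \<in> borel_measurable Q"
  by (rule measurable_from_past[OF empirical_measurable_past])

lemma measurable_limit_empirical [measurable]:
  assumes [measurable]: "B \<in> sets M"
  shows "limit_empirical B \<in> borel_measurable Q"
  unfolding limit_empirical_def[abs_def] by measurable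

lemma measurable_W [measurable]:
  assumes [measurable]: "B \<in> sets M"
  shows "W n B \<in> borel_measurable Q"
  unfolding W_def[abs_def] by measurable

lemma integrable_boundedI:
  fixes g :: "(nat \<Rightarrow> 'a) \<Rightarrow> real"
  assumes "g \<in> borel_measurable Q" "\<And>\<omega>. \<bar>g \<omega>\<bar> \<le> c"
  shows "integrable Q g"
  using assms by (intro integrable_const_bound[of _ c]) auto

lemma integrable_unitI:
  fixes g :: "(nat \<Rightarrow> 'a) \<Rightarrow> real"
  assumes "g \<in> borel_measurable Q" and g: "\<And>\<omega>. 0 \<le> g \<omega>" "\<And>\<omega>. g \<omega> \<le> 1"
  shows "integrable Q g"
  using assms(1) by (rule integrable_boundedI[of _ 1]) (use g in simp)

lemma integrable_hit: "B \<in> sets M \<Longrightarrow> integrable Q (\<lambda>\<omega>. indicator B (\<omega> k) :: real)"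
  by (intro integrable_unitI) (auto simp: indicator_def)

lemma integrable_empirical: "B \<in> sets M \<Longrightarrow> integrable Q (empirical n B)"
  by (intro integrable_unitI measurable_empirical empirical_nonneg empirical_le_1)

lemma integrable_limit_empirical: "B \<in> sets M \<Longrightarrow> integrable Q (limit_empirical B)"
  by (intro integrable_unitI measurable_limit_empirical limit_empirical_bounds)

lemma cond_exp_tower:
  assumes "n \<le> m" "integrable Q g" "h \<in> borel_measurable Q"
    and "AE \<omega> in Q. real_cond_exp Q (past M m) g \<omega> = h \<omega>"
  shows "AE \<omega> in Q. real_cond_exp Q (past M n) h \<omega> = real_cond_exp Q (past M n) g \<omega>"
proof -
  have "AE \<omega> in Q. real_cond_exp Q (past M n) (real_cond_exp Q (past M m) g) \<omega>
      = real_cond_exp Q (past M n) h \<omega>"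
    using assms borel_measurable_cond_exp2 by (intro past.real_cond_exp_cong) auto
  moreover have "AE \<omega> in Q. real_cond_exp Q (past M n) (real_cond_exp Q (past M m) g) \<omega>
      = real_cond_exp Q (past M n) g \<omega>"
    by (intro past.real_cond_exp_nested_subalg subalgebra_Q past_mono assms)
  ultimately show ?thesis by eventually_elim simp
qed

text \<open>
  If all later observations have the same conditional probability \<open>V\<close> of hitting \<open>B\<close>, then over a
  past event the integrals of \<open>\<mu>\<^sub>m(B)\<close> are Cesaro means of an eventually constant sequence, so they
  tend to the integral of \<open>V\<close>; by dominated convergence they also tend to that of \<open>\<mu>(B)\<close>.
\<close>

lemma cond_exp_limit_empirical:
  assumes B: "B \<in> sets M"
    and V: "V \<in> borel_measurable (past M n)" "integrable Q V"
    and hit: "\<And>k. n \<le> k \<Longrightarrow>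
      AE \<omega> in Q. real_cond_exp Q (past M n) (\<lambda>\<omega>. indicator B (\<omega> k)) \<omega> = V \<omega>"
    and conv: "AE \<omega> in Q. convergent (\<lambda>n. empirical n B \<omega>)"
  shows "AE \<omega> in Q. real_cond_exp Q (past M n) (limit_empirical B) \<omega> = V \<omega>"
proof (rule past.real_cond_exp_charact[OF _ integrable_limit_empirical[OF B] V(2,1)])
  fix A assume A: "A \<in> sets (past M n)"
  note [measurable] = sets_from_past[OF A] B
  let ?h = "\<lambda>k. \<integral>\<omega>\<in>A. (indicator B (\<omega> k) :: real) \<partial>Q" and ?v = "\<integral>\<omega>\<in>A. V \<omega> \<partial>Q"
  have h: "?h k = ?v" if "n \<le> k" for k
  proof -
    have "?h k = (\<integral>\<omega>\<in>A. real_cond_exp Q (past M n) (\<lambda>\<omega>. indicator B (\<omega> k)) \<omega> \<partial>Q)"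
      by (rule past.real_cond_exp_intA[OF integrable_hit[OF B] A])
    also have "\<dots> = ?v"
      using V(2) hit[OF that] by (intro set_lebesgue_integral_cong_AE) auto
    finally show ?thesis .
  qed
  have emp: "(\<integral>\<omega>\<in>A. empirical m B \<omega> \<partial>Q) = (\<Sum>k<m. ?h k) / real m" for m
  proof -
    have "(\<Sum>k<m. ?h k) = (\<integral>\<omega>. (\<Sum>k<m. indicator A \<omega> *\<^sub>R (indicator B (\<omega> k) :: real)) \<partial>Q)"
      unfolding set_lebesgue_integral_def
      by (rule Bochner_Integration.integral_sum[symmetric])
         (rule integrable_mult_indicator[OF sets_from_past[OF A] integrable_hit[OF B]])
    moreover have "(\<integral>\<omega>\<in>A. empirical m B \<omega> \<partial>Q)
        = (\<integral>\<omega>. (\<Sum>k<m. indicator A \<omega> *\<^sub>R (indicator B (\<omega> k) :: real)) / real m \<partial>Q)"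
      unfolding set_lebesgue_integral_def
      by (intro Bochner_Integration.integral_cong refl) (simp add: empirical_def sum_distrib_left)
    ultimately show ?thesis by simp
  qed
  have "(\<lambda>m. \<integral>\<omega>\<in>A. empirical m B \<omega> \<partial>Q) \<longlonglongrightarrow> (\<integral>\<omega>\<in>A. limit_empirical B \<omega> \<partial>Q)"
    unfolding set_lebesgue_integral_def
  proof (rule integral_dominated_convergence[where w = "\<lambda>_. 1"])
    show "AE \<omega> in Q. (\<lambda>m. indicator A \<omega> *\<^sub>R empirical m B \<omega>) \<longlonglongrightarrow> indicator A \<omega> *\<^sub>R limit_empirical B \<omega>"
      using conv by eventually_elim (intro tendsto_intros empirical_tendsto_limit)
    show "AE \<omega> in Q. norm (indicator A \<omega> *\<^sub>R empirical m B \<omega>) \<le> 1" for m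
      using empirical_nonneg[of m B] empirical_le_1[of m B] by (auto simp: indicator_def)
  qed auto
  moreover have "(\<lambda>m. \<integral>\<omega>\<in>A. empirical m B \<omega> \<partial>Q) \<longlonglongrightarrow> ?v"
  proof -
    have split: "(\<Sum>k<m. ?h k) = (\<Sum>k<n. ?h k) + (real m - real n) * ?v" if "n \<le> m" for m
      using that by (induction m rule: dec_induct) (simp_all add: h algebra_simps)
    have "((\<Sum>k<n. ?h k) - real n * ?v) * (1 / real m) + ?v = (\<integral>\<omega>\<in>A. empirical m B \<omega> \<partial>Q)"
      if m: "Suc n \<le> m" for m
    proof -
      have "(s - real n * v) * (1 / real m) + v = (s + (real m - real n) * v) / real m" for s v :: real
        using m by (simp add: field_simps)
      then show ?thesis
        using split[OF Suc_leD[OF m]] by (simp only: emp)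
    qed
    then have "eventually (\<lambda>m. ((\<Sum>k<n. ?h k) - real n * ?v) * (1 / real m) + ?v
        = (\<integral>\<omega>\<in>A. empirical m B \<omega> \<partial>Q)) sequentially"
      by (rule eventually_sequentiallyI)
    moreover have "(\<lambda>m. ((\<Sum>k<n. ?h k) - real n * ?v) * (1 / real m) + ?v) \<longlonglongrightarrow> 
      ((\<Sum>k<n. ?h k) - real n * ?v) * 0 + ?v"
      by (intro tendsto_intros lim_1_over_n)
    ultimately have "(\<lambda>m. \<integral>\<omega>\<in>A. empirical m B \<omega> \<partial>Q)
        \<longlonglongrightarrow> ((\<Sum>k<n. ?h k) - real n * ?v) * 0 + ?v"
      by (rule Lim_transform_eventually[rotated])
    then show ?thesis by simp
  qed
  ultimately show "(\<integral>\<omega>\<in>A. limit_empirical B \<omega> \<partial>Q) = ?v"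
    by (rule LIMSEQ_unique)
qed

lemma cond_exp_W:
  assumes B: "B \<in> sets M"
    and V: "V \<in> borel_measurable (past M n)" "integrable Q V"
    and hit: "\<And>k. n \<le> k \<Longrightarrow>
      AE \<omega> in Q. real_cond_exp Q (past M n) (\<lambda>\<omega>. indicator B (\<omega> k)) \<omega> = V \<omega>"
    and conv: "AE \<omega> in Q. convergent (\<lambda>n. empirical n B \<omega>)"
  shows "AE \<omega> in Q. real_cond_exp Q (past M n) (W n B) \<omega> = sqrt (real n) * (empirical n B \<omega> - V \<omega>)"
proof -
  have "AE \<omega> in Q. real_cond_exp Q (past M n) (W n B) \<omega>
    = sqrt (real n) * real_cond_exp Q (past M n) (\<lambda>\<omega>. empirical n B \<omega> - limit_empirical B \<omega>) \<omega>"
    unfolding W_def[abs_def]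
    by (intro past.real_cond_exp_cmult Bochner_Integration.integrable_diff
        integrable_empirical integrable_limit_empirical B)
  moreover have "AE \<omega> in Q. real_cond_exp Q (past M n) (\<lambda>\<omega>. empirical n B \<omega> - limit_empirical B \<omega>) \<omega>
    = real_cond_exp Q (past M n) (empirical n B) \<omega> - real_cond_exp Q (past M n) (limit_empirical B) \<omega>"
    by (intro past.real_cond_exp_diff integrable_empirical integrable_limit_empirical B)
  moreover have "AE \<omega> in Q. real_cond_exp Q (past M n) (empirical n B) \<omega> = empirical n B \<omega>"
    by (intro past.real_cond_exp_F_meas integrable_empirical empirical_measurable_past B)
  moreover have "AE \<omega> in Q. real_cond_exp Q (past M n) (limit_empirical B) \<omega> = V \<omega>"
    by (rule cond_exp_limit_empirical[OF B V hit conv])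
  ultimately show ?thesis by eventually_elim simp
qed

end

section \<open>Ferguson-Dirichlet laws\<close>

locale ferguson_dirichlet_process = coordinate_process M Q
  for M :: "'a measure" and Q :: "(nat \<Rightarrow> 'a) measure" +
  fixes \<alpha> :: real
  assumes \<alpha>_pos: "0 < \<alpha>"
    and predictive_eq: "B \<in> sets M \<Longrightarrow> 1 \<le> n \<Longrightarrow> AE \<omega> in Q. predictive M Q n B \<omega>
        = (\<alpha> * prob {\<omega> \<in> space Q. \<omega> 0 \<in> B} + real n * empirical n B \<omega>) / (\<alpha> + real n)"
begin

text \<open>
  The predictive probability of \<open>B\<close> after \<open>n\<close> draws from a Polya urn, as a function defined
  everywhere rather than as a version of a conditional expectation.
\<close>

definition urn :: "nat \<Rightarrow> 'a set \<Rightarrow> (nat \<Rightarrow> 'a) \<Rightarrow> real" where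
  "urn n B \<omega> = (\<alpha> * prob {\<omega> \<in> space Q. \<omega> 0 \<in> B} + real n * empirical n B \<omega>) / (\<alpha> + real n)"

lemma urn_nonneg: "0 \<le> urn n B \<omega>"
  using \<alpha>_pos by (simp add: urn_def empirical_nonneg)

lemma urn_le_1: "urn n B \<omega> \<le> 1"
proof -
  have "\<alpha> * prob {\<omega> \<in> space Q. \<omega> 0 \<in> B} \<le> \<alpha> * 1" "real n * empirical n B \<omega> \<le> real n * 1"
    using \<alpha>_pos empirical_le_1 by (intro mult_left_mono; simp)+
  then have "\<alpha> * prob {\<omega> \<in> space Q. \<omega> 0 \<in> B} + real n * empirical n B \<omega> \<le> \<alpha> + real n"
    by linarith
  then show ?thesis using \<alpha>_pos by (simp add: urn_def divide_le_eq_1)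
qed

lemma urn_measurable_past: "B \<in> sets M \<Longrightarrow> urn n B \<in> borel_measurable (past M n)"
  unfolding urn_def[abs_def] using empirical_measurable_past[of B M n] by simp

lemma measurable_urn [measurable]: "B \<in> sets M \<Longrightarrow> urn n B \<in> borel_measurable Q"
  by (rule measurable_from_past[OF urn_measurable_past])

lemma integrable_urn: "B \<in> sets M \<Longrightarrow> integrable Q (urn n B)"
  by (intro integrable_unitI measurable_urn urn_nonneg urn_le_1)

lemma urn_Suc:
  "urn (Suc n) B \<omega> = (\<alpha> + real n) / (\<alpha> + real (Suc n)) * urn n B \<omega>
     + 1 / (\<alpha> + real (Suc n)) * indicator B (\<omega> n)"
proof -
  have "(\<alpha> + real n) * urn n B \<omega> = \<alpha> * prob {\<omega> \<in> space Q. \<omega> 0 \<in> B} + real n * empirical n B \<omega>"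
    using \<alpha>_pos by (simp add: urn_def)
  then have "\<alpha> * prob {\<omega> \<in> space Q. \<omega> 0 \<in> B} + real (Suc n) * empirical (Suc n) B \<omega>
      = (\<alpha> + real n) * urn n B \<omega> + indicator B (\<omega> n)"
    unfolding empirical_Suc by simp
  then have "urn (Suc n) B \<omega> = ((\<alpha> + real n) * urn n B \<omega> + indicator B (\<omega> n)) / (\<alpha> + real (Suc n))"
    by (simp only: urn_def[of "Suc n"])
  then show ?thesis
    by (simp only: add_divide_distrib[of "(\<alpha> + real n) * urn n B \<omega>"] times_divide_eq_left mult_1)
qed

lemma cond_exp_urn_Suc:
  assumes B: "B \<in> sets M" and n: "1 \<le> n"
  shows "AE \<omega> in Q. real_cond_exp Q (past M n) (urn (Suc n) B) \<omega> = urn n B \<omega>"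
proof -
  let ?c = "(\<alpha> + real n) / (\<alpha> + real (Suc n))" and ?d = "1 / (\<alpha> + real (Suc n))"
  let ?E = "real_cond_exp Q (past M n)"
  have "urn (Suc n) B = (\<lambda>\<omega>. ?c * urn n B \<omega> + ?d * indicator B (\<omega> n))"
    by (rule ext) (rule urn_Suc)
  then have "AE \<omega> in Q. ?E (urn (Suc n) B) \<omega>
      = ?E (\<lambda>\<omega>. ?c * urn n B \<omega>) \<omega> + ?E (\<lambda>\<omega>. ?d * indicator B (\<omega> n)) \<omega>"
    by (simp only:) (intro past.real_cond_exp_add integrable_mult_right integrable_urn integrable_hit B)
  moreover have "AE \<omega> in Q. ?E (\<lambda>\<omega>. ?c * urn n B \<omega>) \<omega> = ?c * ?E (urn n B) \<omega>"
    by (intro past.real_cond_exp_cmult integrable_urn B)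
  moreover have "AE \<omega> in Q. ?E (\<lambda>\<omega>. ?d * indicator B (\<omega> n)) \<omega> = ?d * ?E (\<lambda>\<omega>. indicator B (\<omega> n)) \<omega>"
    by (intro past.real_cond_exp_cmult integrable_hit B)
  moreover have "AE \<omega> in Q. ?E (urn n B) \<omega> = urn n B \<omega>"
    by (intro past.real_cond_exp_F_meas integrable_urn urn_measurable_past B)
  moreover have "AE \<omega> in Q. ?E (\<lambda>\<omega>. indicator B (\<omega> n)) \<omega> = urn n B \<omega>"
    using predictive_eq[OF assms] unfolding predictive_def urn_def .
  ultimately show ?thesis
  proof eventually_elim
    case (elim \<omega>)
    have "?c + ?d = 1" using \<alpha>_pos by (simp add: add_divide_distrib[symmetric])
    then have "?c * urn n B \<omega> + ?d * urn n B \<omega> = urn n B \<omega>"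
      by (simp only: distrib_right[symmetric])
    with elim show ?case by simp
  qed
qed

text \<open>
  The urn proportions form a martingale. Hence a Ferguson-Dirichlet law satisfies the c.i.d. condition
  for \<open>n \<ge> 1\<close> (\<open>cond_exp_hit\<close> below), without recourse to exchangeability.
\<close>

lemma cond_exp_urn:
  assumes B: "B \<in> sets M" and n: "1 \<le> n" "n \<le> k"
  shows "AE \<omega> in Q. real_cond_exp Q (past M n) (urn k B) \<omega> = urn n B \<omega>"
  using n(2)
proof (induction k rule: dec_induct)
  case base
  show ?case
    by (intro past.real_cond_exp_F_meas integrable_urn urn_measurable_past B)
next
  case (step k)
  have "AE \<omega> in Q. real_cond_exp Q (past M n) (urn k B) \<omega> = real_cond_exp Q (past M n) (urn (Suc k) B) \<omega>"
    using step n by (intro cond_exp_tower[of n k] integrable_urn measurable_urn cond_exp_urn_Suc B) auto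
  with step show ?case by auto
qed

lemma cond_exp_hit:
  assumes B: "B \<in> sets M" and n: "1 \<le> n" "n \<le> k"
  shows "AE \<omega> in Q. real_cond_exp Q (past M n) (\<lambda>\<omega>. indicator B (\<omega> k)) \<omega> = urn n B \<omega>"
proof -
  have "AE \<omega> in Q. real_cond_exp Q (past M n) (urn k B) \<omega>
      = real_cond_exp Q (past M n) (\<lambda>\<omega>. indicator B (\<omega> k)) \<omega>"
    using predictive_eq[of B k] n
    by (intro cond_exp_tower[of n k] integrable_hit measurable_urn B)
       (auto simp: predictive_def urn_def B)
  with cond_exp_urn[OF assms] show ?thesis by auto
qed

text \<open>
  The urn proportion is a bounded martingale, hence converges, and \<open>\<mu>\<^sub>n(B)\<close> is an affine function of it
  with coefficients tending to \<open>1\<close> and \<open>0\<close>.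
\<close>

lemma AE_convergent_empirical:
  assumes B: "B \<in> sets M"
  shows "AE \<omega> in Q. convergent (\<lambda>n. empirical n B \<omega>)"
proof -
  interpret urn: bounded_submartingale Q "\<lambda>n. past M (Suc n)" "\<lambda>n. urn (Suc n) B" 1
  proof
    show "subalgebra Q (past M (Suc n))" for n by (rule subalgebra_Q)
    show "sets (past M (Suc n)) \<subseteq> sets (past M (Suc (Suc n)))" for n
      using past_mono[of "Suc n" "Suc (Suc n)" M] by (simp add: subalgebra_def)
    show "urn (Suc n) B \<in> borel_measurable (past M (Suc n))" for n
      by (rule urn_measurable_past[OF B])
    show "integrable Q (urn (Suc n) B)" for n by (rule integrable_urn[OF B])
    show "0 \<le> urn (Suc n) B \<omega>" for n \<omega> by (rule urn_nonneg)
    show "(\<integral>\<omega>\<in>A. urn (Suc n) B \<omega> \<partial>Q) \<le> (\<integral>\<omega>\<in>A. urn (Suc (Suc n)) B \<omega> \<partial>Q)"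
      if A: "A \<in> sets (past M (Suc n))" for A n
    proof -
      note [measurable] = sets_from_past[OF A] B
      have "(\<integral>\<omega>\<in>A. urn (Suc (Suc n)) B \<omega> \<partial>Q)
          = (\<integral>\<omega>\<in>A. real_cond_exp Q (past M (Suc n)) (urn (Suc (Suc n)) B) \<omega> \<partial>Q)"
        by (rule past.real_cond_exp_intA[OF integrable_urn[OF B] A])
      also have "\<dots> = (\<integral>\<omega>\<in>A. urn (Suc n) B \<omega> \<partial>Q)"
        using cond_exp_urn_Suc[OF B, of "Suc n"] by (intro set_lebesgue_integral_cong_AE) auto
      finally show ?thesis by simp
    qed
    show "(\<integral>\<omega>. urn (Suc n) B \<omega> \<partial>Q) \<le> 1" for n
      using integral_mono[OF integrable_urn[OF B] integrable_const, of "Suc n" 1] urn_le_1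
      by (simp add: prob_space)
  qed
  from urn.AE_convergent show ?thesis
  proof eventually_elim
    case (elim \<omega>)
    then obtain l where l: "l < \<infinity>" "(\<lambda>n. ennreal (urn (Suc n) B \<omega>)) \<longlonglongrightarrow> l" by blast
    then obtain r where r: "l = ennreal r" "0 \<le> r"
      by (cases l) auto
    have "(\<lambda>n. urn (Suc n) B \<omega>) \<longlonglongrightarrow> r"
      using l(2) r by (intro tendsto_ennrealD) (auto simp: urn_nonneg)
    then have urn_lim: "(\<lambda>n. urn n B \<omega>) \<longlonglongrightarrow> r"
      by (rule LIMSEQ_imp_Suc)
    let ?q = "prob {\<omega> \<in> space Q. \<omega> 0 \<in> B}"
    have "eventually (\<lambda>n. (\<alpha> * (1 / real n) + 1) * urn n B \<omega> - \<alpha> * ?q * (1 / real n) = empirical n B \<omega>) sequentially"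
    proof (rule eventually_sequentiallyI[of 1])
      fix n :: nat assume n: "1 \<le> n"
      have "(\<alpha> + real n) * urn n B \<omega> = \<alpha> * ?q + real n * empirical n B \<omega>"
        using \<alpha>_pos by (simp add: urn_def)
      then have "((\<alpha> + real n) * urn n B \<omega> - \<alpha> * ?q) / real n = empirical n B \<omega>"
        using n by simp
      moreover have "((\<alpha> + real n) * urn n B \<omega> - \<alpha> * ?q) / real n
          = (\<alpha> * (1 / real n) + 1) * urn n B \<omega> - \<alpha> * ?q * (1 / real n)"
        using n by (simp add: field_simps)
      ultimately show "(\<alpha> * (1 / real n) + 1) * urn n B \<omega> - \<alpha> * ?q * (1 / real n) = empirical n B \<omega>"
        by simp
    qed
    moreover have "(\<lambda>n. (\<alpha> * (1 / real n) + 1) * urn n B \<omega> - \<alpha> * ?q * (1 / real n))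
        \<longlonglongrightarrow> (\<alpha> * 0 + 1) * r - \<alpha> * ?q * 0"
      by (intro tendsto_intros urn_lim lim_1_over_n)
    ultimately have "(\<lambda>n. empirical n B \<omega>) \<longlonglongrightarrow> (\<alpha> * 0 + 1) * r - \<alpha> * ?q * 0"
      by (rule Lim_transform_eventually[rotated])
    then show ?case by (auto simp: convergent_def)
  qed
qed

text \<open>
  With \<open>q\<close> the probability of \<open>B\<close> for the first draw, the conditional expectation times \<open>\<surd>n\<close> is
  \<open>n \<alpha> (\<mu>\<^sub>n(B) - q) / (\<alpha> + n)\<close>: a Ferguson-Dirichlet predictive is within \<open>\<alpha> / n\<close> of the empirical
  measure, uniformly in \<open>B\<close>.
\<close>

lemma cond_exp_W_bound:
  assumes B: "B \<in> sets M" and n: "1 \<le> n"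
  shows "AE \<omega> in Q. sqrt (real n) * \<bar>real_cond_exp Q (past M n) (W n B) \<omega>\<bar> \<le> \<alpha>"
proof -
  have "AE \<omega> in Q. real_cond_exp Q (past M n) (W n B) \<omega> = sqrt (real n) * (empirical n B \<omega> - urn n B \<omega>)"
    by (intro cond_exp_W B urn_measurable_past integrable_urn AE_convergent_empirical cond_exp_hit n)
  then show ?thesis
  proof eventually_elim
    case (elim \<omega>)
    let ?q = "prob {\<omega> \<in> space Q. \<omega> 0 \<in> B}"
    have "(\<alpha> + real n) * (empirical n B \<omega> - urn n B \<omega>) = \<alpha> * (empirical n B \<omega> - ?q)"
    proof -
      have "(\<alpha> + real n) * urn n B \<omega> = \<alpha> * ?q + real n * empirical n B \<omega>"
        using \<alpha>_pos by (simp add: urn_def)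
      then show ?thesis by (simp add: algebra_simps)
    qed
    then have "(\<alpha> + real n) * \<bar>empirical n B \<omega> - urn n B \<omega>\<bar> = \<alpha> * \<bar>empirical n B \<omega> - ?q\<bar>"
      using \<alpha>_pos abs_mult[of "\<alpha> + real n" "empirical n B \<omega> - urn n B \<omega>"]
        abs_mult[of \<alpha> "empirical n B \<omega> - ?q"] by simp
    also have "\<dots> \<le> \<alpha> * 1"
    proof (rule mult_left_mono)
      have "0 \<le> ?q" "?q \<le> 1" by simp_all
      then show "\<bar>empirical n B \<omega> - ?q\<bar> \<le> 1"
        using empirical_nonneg[of n B \<omega>] empirical_le_1[of n B \<omega>] by linarith
    qed (use \<alpha>_pos in simp)
    finally have "real n * \<bar>empirical n B \<omega> - urn n B \<omega>\<bar> \<le> \<alpha>"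
    proof -
      have "0 \<le> \<alpha> * \<bar>empirical n B \<omega> - urn n B \<omega>\<bar>"
        using \<alpha>_pos by simp
      moreover assume "(\<alpha> + real n) * \<bar>empirical n B \<omega> - urn n B \<omega>\<bar> \<le> \<alpha> * 1"
      ultimately show ?thesis by (simp add: distrib_right)
    qed
    with elim show ?case by (simp add: abs_mult mult.assoc[symmetric])
  qed
qed

end

section \<open>Suprema over classes of sets\<close>

lemma sup_norm_cmult: "0 \<le> c \<Longrightarrow> sup_norm D (\<lambda>B. c * F B) = ennreal c * sup_norm D F"
  by (simp add: sup_norm_def abs_mult ennreal_mult SUP_mult_left_ennreal)

lemma sup_norm_cong: "(\<And>B. B \<in> D \<Longrightarrow> F B = G B) \<Longrightarrow> sup_norm D F = sup_norm D G"
  by (simp add: sup_norm_def)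

lemma sup_norm_least: "(\<And>B. B \<in> D \<Longrightarrow> \<bar>F B\<bar> \<le> c) \<Longrightarrow> sup_norm D F \<le> ennreal c"
  unfolding sup_norm_def by (intro SUP_least ennreal_leI)

lemma measurable_sup_norm:
  assumes "countable D" "\<And>B. B \<in> D \<Longrightarrow> F B \<in> borel_measurable N"
  shows "(\<lambda>\<omega>. sup_norm D (\<lambda>B. F B \<omega>)) \<in> borel_measurable N"
  unfolding sup_norm_def using assms by (intro borel_measurable_SUP) auto

text \<open>
  Integration theory needs the sup-norm as a real number; for classes on which \<open>F\<close> is bounded the
  conversion loses nothing.
\<close>

definition real_sup_norm :: "'a set set \<Rightarrow> ('a set \<Rightarrow> real) \<Rightarrow> real" where
  "real_sup_norm D F = enn2real (sup_norm D F)"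

lemma real_sup_norm_nonneg: "0 \<le> real_sup_norm D F"
  by (simp add: real_sup_norm_def)

lemma real_sup_norm_le:
  assumes "\<And>B. B \<in> D \<Longrightarrow> \<bar>F B\<bar> \<le> c" "0 \<le> c"
  shows "real_sup_norm D F \<le> c"
  unfolding real_sup_norm_def using sup_norm_least[of D F c] assms by (intro enn2real_leI) auto

lemma ennreal_real_sup_norm:
  assumes "\<And>B. B \<in> D \<Longrightarrow> \<bar>F B\<bar> \<le> c"
  shows "ennreal (real_sup_norm D F) = sup_norm D F"
proof -
  have "sup_norm D F < \<top>"
    by (rule le_less_trans[OF sup_norm_least[of D F c, OF assms] ennreal_less_top])
  then show ?thesis by (simp add: real_sup_norm_def)
qed

lemma abs_le_real_sup_norm:
  assumes "\<And>B. B \<in> D \<Longrightarrow> \<bar>F B\<bar> \<le> c" "B \<in> D"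
  shows "\<bar>F B\<bar> \<le> real_sup_norm D F"
proof -
  have "ennreal \<bar>F B\<bar> \<le> sup_norm D F"
    unfolding sup_norm_def by (rule SUP_upper[OF assms(2)])
  then have "ennreal \<bar>F B\<bar> \<le> ennreal (real_sup_norm D F)"
    using ennreal_real_sup_norm[of D F c, OF assms(1)] by simp
  then show ?thesis by (simp add: real_sup_norm_nonneg)
qed

section \<open>The submartingale of normalised prediction errors\<close>

context coordinate_process begin

text \<open>
  A version of a conditional probability may leave the unit interval on a null set. Clipping it yields
  a version that is bounded everywhere, so that suprema over \<open>B\<close> are finite everywhere.
\<close>

definition clipped :: "nat \<Rightarrow> 'a set \<Rightarrow> (nat \<Rightarrow> 'a) \<Rightarrow> real" where
  "clipped n B \<omega> = max 0 (min 1 (predictive M Q n B \<omega>))"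

definition gap :: "nat \<Rightarrow> 'a set \<Rightarrow> (nat \<Rightarrow> 'a) \<Rightarrow> real" where
  "gap n B \<omega> = real n * (empirical n B \<omega> - clipped n B \<omega>)"

lemma clipped_bounds: "0 \<le> clipped n B \<omega>" "clipped n B \<omega> \<le> 1"
  by (simp_all add: clipped_def)

lemma clipped_measurable_past: "clipped n B \<in> borel_measurable (past M n)"
  unfolding clipped_def[abs_def] predictive_def by measurable

lemma integrable_clipped: "integrable Q (clipped n B)"
  by (intro integrable_unitI clipped_bounds measurable_from_past[OF clipped_measurable_past])

lemma gap_measurable_past: "B \<in> sets M \<Longrightarrow> gap n B \<in> borel_measurable (past M n)"
  unfolding gap_def[abs_def]
  by (intro borel_measurable_times borel_measurable_diff borel_measurable_const
      empirical_measurable_past clipped_measurable_past)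

lemma gap_abs_le: "\<bar>gap n B \<omega>\<bar> \<le> real n"
proof -
  have "\<bar>empirical n B \<omega> - clipped n B \<omega>\<bar> \<le> 1"
    using empirical_nonneg[of n B \<omega>] empirical_le_1[of n B \<omega>] clipped_bounds[of n B \<omega>]
    by linarith
  then show ?thesis
    unfolding gap_def abs_mult using mult_left_mono[of _ 1 "real n"] by simp
qed

lemma integrable_gap: "B \<in> sets M \<Longrightarrow> integrable Q (gap n B)"
  by (rule integrable_boundedI[OF measurable_from_past[OF gap_measurable_past] gap_abs_le])

lemma AE_clipped:
  assumes B: "B \<in> sets M"
  shows "AE \<omega> in Q. predictive M Q n B \<omega> = clipped n B \<omega>"
proof -
  have "AE \<omega> in Q. predictive M Q n B \<omega> \<ge> 0" "AE \<omega> in Q. predictive M Q n B \<omega> \<le> 1"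
    unfolding predictive_def
    by (intro past.real_cond_exp_ge_c past.real_cond_exp_le_c integrable_hit B; simp add: indicator_def)+
  then show ?thesis by eventually_elim (simp add: clipped_def)
qed

lemma cond_exp_hit_clipped:
  assumes "cid M Q" and B: "B \<in> sets M" and "n \<le> k"
  shows "AE \<omega> in Q. real_cond_exp Q (past M n) (\<lambda>\<omega>. indicator B (\<omega> k)) \<omega> = clipped n B \<omega>"
proof -
  have "AE \<omega> in Q. real_cond_exp Q (past M n) (\<lambda>\<omega>. indicator B (\<omega> k)) \<omega> = predictive M Q n B \<omega>"
    using assms unfolding cid_def predictive_def by blast
  with AE_clipped[OF B, of n] show ?thesis by eventually_elim simp
qed

text \<open>
  The martingale property rests on \<open>E(a\<^sub>n\<^sub>+\<^sub>1(B) | G\<^sub>n) = a\<^sub>n(B)\<close>, which the c.i.d. condition provides by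
  comparing the observations with index \<open>n\<close> and \<open>n + 1\<close>.
\<close>

lemma cond_exp_gap_Suc:
  assumes cid: "cid M Q" and B: "B \<in> sets M"
  shows "AE \<omega> in Q. real_cond_exp Q (past M n) (gap (Suc n) B) \<omega> = gap n B \<omega>"
proof -
  let ?E = "real_cond_exp Q (past M n)"
  have "gap (Suc n) B = (\<lambda>\<omega>. (real n * empirical n B \<omega> + indicator B (\<omega> n)) - real (Suc n) * clipped (Suc n) B \<omega>)"
    unfolding gap_def[abs_def] right_diff_distrib empirical_Suc ..
  then have "AE \<omega> in Q. ?E (gap (Suc n) B) \<omega>
      = ?E (\<lambda>\<omega>. real n * empirical n B \<omega> + indicator B (\<omega> n)) \<omega> - ?E (\<lambda>\<omega>. real (Suc n) * clipped (Suc n) B \<omega>) \<omega>"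
    by (simp only:) (intro past.real_cond_exp_diff Bochner_Integration.integrable_add integrable_mult_right
      integrable_empirical integrable_hit integrable_clipped B)
  moreover have "AE \<omega> in Q. ?E (\<lambda>\<omega>. real n * empirical n B \<omega> + indicator B (\<omega> n)) \<omega>
      = ?E (\<lambda>\<omega>. real n * empirical n B \<omega>) \<omega> + ?E (\<lambda>\<omega>. indicator B (\<omega> n)) \<omega>"
    by (intro past.real_cond_exp_add integrable_mult_right integrable_empirical integrable_hit B)
  moreover have "AE \<omega> in Q. ?E (\<lambda>\<omega>. real n * empirical n B \<omega>) \<omega> = real n * empirical n B \<omega>"
    by (intro past.real_cond_exp_F_meas integrable_mult_right integrable_empirical
        borel_measurable_times borel_measurable_const empirical_measurable_past B)
  moreover have "AE \<omega> in Q. ?E (\<lambda>\<omega>. indicator B (\<omega> n)) \<omega> = clipped n B \<omega>"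
    by (rule cond_exp_hit_clipped[OF cid B order_refl])
  moreover have "AE \<omega> in Q. ?E (\<lambda>\<omega>. real (Suc n) * clipped (Suc n) B \<omega>) \<omega> = real (Suc n) * ?E (clipped (Suc n) B) \<omega>"
    by (intro past.real_cond_exp_cmult integrable_clipped)
  moreover have "AE \<omega> in Q. ?E (clipped (Suc n) B) \<omega> = ?E (\<lambda>\<omega>. indicator B (\<omega> (Suc n))) \<omega>"
    by (intro cond_exp_tower[of n "Suc n"] integrable_hit B measurable_from_past[OF clipped_measurable_past]
        cond_exp_hit_clipped[OF cid B]) auto
  moreover have "AE \<omega> in Q. ?E (\<lambda>\<omega>. indicator B (\<omega> (Suc n))) \<omega> = clipped n B \<omega>"
    by (rule cond_exp_hit_clipped[OF cid B]) simp
  ultimately show ?thesis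
    by eventually_elim (simp add: gap_def algebra_simps)
qed

definition sup_gap :: "'a set set \<Rightarrow> nat \<Rightarrow> (nat \<Rightarrow> 'a) \<Rightarrow> real" where
  "sup_gap D n \<omega> = real_sup_norm D (\<lambda>B. gap n B \<omega>)"

lemma sup_gap_nonneg: "0 \<le> sup_gap D n \<omega>"
  by (simp add: sup_gap_def real_sup_norm_nonneg)

lemma sup_gap_le: "sup_gap D n \<omega> \<le> real n"
  by (simp add: sup_gap_def real_sup_norm_le gap_abs_le)

lemma abs_gap_le_sup_gap: "B \<in> D \<Longrightarrow> \<bar>gap n B \<omega>\<bar> \<le> sup_gap D n \<omega>"
  unfolding sup_gap_def by (rule abs_le_real_sup_norm[OF gap_abs_le])

lemma sup_gap_measurable_past:
  assumes "countable D" "D \<subseteq> sets M"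
  shows "sup_gap D n \<in> borel_measurable (past M n)"
  unfolding sup_gap_def[abs_def] real_sup_norm_def using assms
  by (intro measurable_compose[OF measurable_sup_norm] borel_measurable_enn2real measurable_ident
      gap_measurable_past) auto

lemma integrable_sup_gap:
  assumes "countable D" "D \<subseteq> sets M"
  shows "integrable Q (sup_gap D n)"
  by (rule integrable_boundedI[OF measurable_from_past[OF sup_gap_measurable_past[OF assms]], of _ "real n"])
     (simp add: sup_gap_nonneg sup_gap_le)

text \<open>
  A countable supremum of absolute values of martingales is a submartingale, as each of them is
  dominated by the conditional expectation of the next supremum.
\<close>

lemma sup_gap_submartingale:
  assumes cid: "cid M Q" and D: "countable D" "D \<subseteq> sets M"
    and K: "\<And>n. (\<integral>\<omega>. sup_gap D n \<omega> \<partial>Q) \<le> K"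
  shows "bounded_submartingale Q (past M) (sup_gap D) K"
proof
  let ?R = "sup_gap D"
  show "subalgebra Q (past M n)" for n by (rule subalgebra_Q)
  show "sets (past M n) \<subseteq> sets (past M (Suc n))" for n
    using past_mono[of n "Suc n" M] by (simp add: subalgebra_def)
  show adapted: "?R n \<in> borel_measurable (past M n)" for n
    by (rule sup_gap_measurable_past[OF D])
  show int: "integrable Q (?R n)" for n
    by (rule integrable_sup_gap[OF D])
  show "0 \<le> ?R n \<omega>" for n \<omega> by (rule sup_gap_nonneg)
  show "(\<integral>\<omega>. ?R n \<omega> \<partial>Q) \<le> K" for n by (rule K)
  show "(\<integral>\<omega>\<in>A. ?R n \<omega> \<partial>Q) \<le> (\<integral>\<omega>\<in>A. ?R (Suc n) \<omega> \<partial>Q)" if A: "A \<in> sets (past M n)" for A n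
  proof -
    let ?E = "real_cond_exp Q (past M n)"
    have "AE \<omega> in Q. \<bar>gap n B \<omega>\<bar> \<le> ?E (?R (Suc n)) \<omega>" if "B \<in> D" for B
    proof -
      have B: "B \<in> sets M" using that D by blast
      have le: "\<bar>gap (Suc n) B \<omega>\<bar> \<le> ?R (Suc n) \<omega>" for \<omega>
        by (rule abs_gap_le_sup_gap[OF that])
      have "AE \<omega> in Q. ?E (gap (Suc n) B) \<omega> \<le> ?E (?R (Suc n)) \<omega>"
        using le by (intro past.real_cond_exp_mono integrable_gap B int) (auto simp: abs_le_iff)
      moreover have "AE \<omega> in Q. ?E (\<lambda>\<omega>. (-1) * gap (Suc n) B \<omega>) \<omega> \<le> ?E (?R (Suc n)) \<omega>"
        using le by (intro past.real_cond_exp_mono integrable_mult_right integrable_gap B int)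
          (auto simp: abs_le_iff)
      moreover have "AE \<omega> in Q. ?E (\<lambda>\<omega>. (-1) * gap (Suc n) B \<omega>) \<omega> = (-1) * ?E (gap (Suc n) B) \<omega>"
        by (intro past.real_cond_exp_cmult integrable_gap B)
      moreover note cond_exp_gap_Suc[OF cid B, of n]
      ultimately show ?thesis by eventually_elim (simp add: abs_le_iff)
    qed
    then have "AE \<omega> in Q. \<forall>B\<in>D. \<bar>gap n B \<omega>\<bar> \<le> ?E (?R (Suc n)) \<omega>"
      using D by (simp add: AE_ball_countable)
    moreover have "AE \<omega> in Q. 0 \<le> ?E (?R (Suc n)) \<omega>"
      by (intro past.real_cond_exp_pos measurable_from_past[OF adapted])
         (simp add: sup_gap_nonneg)
    ultimately have le: "AE \<omega> in Q. ?R n \<omega> \<le> ?E (?R (Suc n)) \<omega>"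
      by eventually_elim (simp add: sup_gap_def real_sup_norm_le)
    have "(\<integral>\<omega>\<in>A. ?R n \<omega> \<partial>Q) \<le> (\<integral>\<omega>\<in>A. ?E (?R (Suc n)) \<omega> \<partial>Q)"
      unfolding set_lebesgue_integral_def
      using le
      by (intro integral_mono_AE integrable_mult_indicator sets_from_past[OF A] int
          past.real_cond_exp_int) (auto simp: indicator_def elim: eventually_mono)
    also have "\<dots> = (\<integral>\<omega>\<in>A. ?R (Suc n) \<omega> \<partial>Q)"
      by (rule past.real_cond_exp_intA[OF int A, symmetric])
    finally show ?thesis .
  qed
qed

end

section \<open>Change of measure\<close>

text \<open>
  A law \<open>P\<close> with a square integrable density \<open>f\<close> relative to a Ferguson-Dirichlet law \<open>Q\<close>.
\<close>

locale ferguson_dirichlet_density = ferguson_dirichlet_process M Q \<alpha> + P: coordinate_process M P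
  for M :: "'a measure" and Q :: "(nat \<Rightarrow> 'a) measure" and \<alpha> :: real
    and P :: "(nat \<Rightarrow> 'a) measure" +
  fixes f :: "(nat \<Rightarrow> 'a) \<Rightarrow> real"
  assumes f_measurable [measurable]: "f \<in> borel_measurable Q"
    and f_nonneg: "AE \<omega> in Q. 0 \<le> f \<omega>"
    and P_eq: "P = density Q (\<lambda>\<omega>. ennreal (f \<omega>))"
    and f_square_integrable: "integrable Q (\<lambda>\<omega>. (f \<omega>)\<^sup>2)"
begin

text \<open>
  The likelihood ratio of \<open>P\<close> and \<open>Q\<close> after \<open>n\<close> observations.
\<close>

abbreviation lik :: "nat \<Rightarrow> (nat \<Rightarrow> 'a) \<Rightarrow> real" where
  "lik n \<equiv> real_cond_exp Q (past M n) f"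

lemma integral_P:
  assumes "g \<in> borel_measurable Q"
  shows "(\<integral>\<omega>. g \<omega> \<partial>P) = (\<integral>\<omega>. f \<omega> * (g \<omega> :: real) \<partial>Q)"
  unfolding P_eq using assms f_nonneg by (subst integral_density) auto

lemma AE_P: "AE \<omega> in Q. S \<omega> \<Longrightarrow> AE \<omega> in P. S \<omega>"
  unfolding P_eq by (subst AE_density) (auto elim: eventually_mono)

lemma f_integrable: "integrable Q f"
proof (rule Bochner_Integration.integrable_bound)
  show "integrable Q (\<lambda>\<omega>. 1 + (f \<omega>)\<^sup>2)"
    using f_square_integrable by simp
  have "\<bar>x\<bar> \<le> 1 + x\<^sup>2" for x :: real
    using sum_power2_ge_zero[of "\<bar>x\<bar> - 1" 0] zero_le_power2[of x] by (simp add: power2_diff)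
  then show "AE \<omega> in Q. norm (f \<omega>) \<le> norm (1 + (f \<omega>)\<^sup>2)"
    by (simp add: abs_of_nonneg)
qed simp

lemma integral_f: "(\<integral>\<omega>. f \<omega> \<partial>Q) = 1"
  using integral_P[of "\<lambda>_. 1"] P.prob_space by simp

lemma lik_measurable [measurable]: "lik n \<in> borel_measurable Q"
  by (rule borel_measurable_cond_exp2)

lemma lik_nonneg: "AE \<omega> in Q. 0 \<le> lik n \<omega>"
  using f_nonneg by (rule past.real_cond_exp_pos) simp

lemma lik_square_integrable: "integrable Q (\<lambda>\<omega>. (lik n \<omega>)\<^sup>2)"
proof (rule Bochner_Integration.integrable_bound)
  show "integrable Q (real_cond_exp Q (past M n) (\<lambda>\<omega>. (f \<omega>)\<^sup>2))"
    by (rule past.real_cond_exp_int(1)[OF f_square_integrable])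
  have "AE \<omega> in Q. (lik n \<omega>)\<^sup>2 \<le> real_cond_exp Q (past M n) (\<lambda>\<omega>. (f \<omega>)\<^sup>2) \<omega>"
    by (rule past.real_cond_exp_jensens_inequality(2)[where I = UNIV and q = "\<lambda>x. x\<^sup>2"])
       (auto simp: f_integrable f_square_integrable convex_power2)
  then show "AE \<omega> in Q. norm ((lik n \<omega>)\<^sup>2) \<le> norm (real_cond_exp Q (past M n) (\<lambda>\<omega>. (f \<omega>)\<^sup>2) \<omega>)"
    by eventually_elim simp
qed simp

lemma f_lik_integrable: "integrable Q (\<lambda>\<omega>. lik n \<omega> * f \<omega>)"
proof (rule Bochner_Integration.integrable_bound)
  show "integrable Q (\<lambda>\<omega>. (lik n \<omega>)\<^sup>2 + (f \<omega>)\<^sup>2)"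
    using lik_square_integrable f_square_integrable by (rule Bochner_Integration.integrable_add)
  have "\<bar>x * y\<bar> \<le> x\<^sup>2 + y\<^sup>2" for x y :: real
  proof -
    have "2 * (\<bar>x\<bar> * \<bar>y\<bar>) \<le> x\<^sup>2 + y\<^sup>2"
      using sum_squares_bound[of "\<bar>x\<bar>" "\<bar>y\<bar>"] by simp
    moreover have "0 \<le> \<bar>x\<bar> * \<bar>y\<bar>" by simp
    ultimately show ?thesis unfolding abs_mult by linarith
  qed
  then show "AE \<omega> in Q. norm (lik n \<omega> * f \<omega>) \<le> norm ((lik n \<omega>)\<^sup>2 + (f \<omega>)\<^sup>2)"
    by (simp add: abs_of_nonneg)
qed simp

lemma lik_error_integrable: "integrable Q (\<lambda>\<omega>. (f \<omega> - lik n \<omega>)\<^sup>2)"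
proof -
  have "integrable Q (\<lambda>\<omega>. (f \<omega>)\<^sup>2 + (lik n \<omega>)\<^sup>2 - 2 * (lik n \<omega> * f \<omega>))"
    by (intro Bochner_Integration.integrable_diff Bochner_Integration.integrable_add integrable_mult_right
        f_square_integrable lik_square_integrable f_lik_integrable)
  then show ?thesis by (simp add: power2_diff algebra_simps)
qed

text \<open>
  Conditional expectation is an orthogonal projection in \<open>L\<^sup>2\<close>; this turns the hypothesis on second
  moments into a rate for the mean square error of the likelihood ratio.
\<close>

lemma lik_pythagoras:
  "(\<integral>\<omega>. (f \<omega> - lik n \<omega>)\<^sup>2 \<partial>Q) = (\<integral>\<omega>. (f \<omega>)\<^sup>2 \<partial>Q) - (\<integral>\<omega>. (lik n \<omega>)\<^sup>2 \<partial>Q)"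
proof -
  have "(\<integral>\<omega>. lik n \<omega> * f \<omega> \<partial>Q) = (\<integral>\<omega>. (lik n \<omega>)\<^sup>2 \<partial>Q)"
    unfolding power2_eq_square
    by (rule past.real_cond_exp_intg(2)[OF f_lik_integrable borel_measurable_cond_exp f_measurable, symmetric])
  moreover have "(\<integral>\<omega>. (f \<omega> - lik n \<omega>)\<^sup>2 \<partial>Q) = (\<integral>\<omega>. (f \<omega>)\<^sup>2 + (lik n \<omega>)\<^sup>2 - 2 * (lik n \<omega> * f \<omega>) \<partial>Q)"
    by (intro Bochner_Integration.integral_cong refl) (simp add: power2_diff)
  moreover have "\<dots> = (\<integral>\<omega>. (f \<omega>)\<^sup>2 \<partial>Q) + (\<integral>\<omega>. (lik n \<omega>)\<^sup>2 \<partial>Q) - 2 * (\<integral>\<omega>. lik n \<omega> * f \<omega> \<partial>Q)"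
    using f_square_integrable lik_square_integrable f_lik_integrable by simp
  ultimately show ?thesis by simp
qed

lemma mult_bounded_integrable:
  fixes g h :: "(nat \<Rightarrow> 'a) \<Rightarrow> real"
  assumes "integrable Q g" "h \<in> borel_measurable Q" "\<And>\<omega>. \<bar>h \<omega>\<bar> \<le> c"
  shows "integrable Q (\<lambda>\<omega>. g \<omega> * h \<omega>)"
proof (rule Bochner_Integration.integrable_bound)
  show "integrable Q (\<lambda>\<omega>. c * \<bar>g \<omega>\<bar>)" using assms(1) by simp
  have "\<bar>g \<omega>\<bar> * \<bar>h \<omega>\<bar> \<le> \<bar>g \<omega>\<bar> * c" for \<omega> by (rule mult_left_mono[OF assms(3)]) simp
  moreover have "0 \<le> c" using assms(3) abs_ge_zero order_trans by blast
  ultimately show "AE \<omega> in Q. norm (g \<omega> * h \<omega>) \<le> norm (c * \<bar>g \<omega>\<bar>)"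
    by (simp add: abs_mult mult.commute)
qed (use assms in measurable)

text \<open>
  Conditional expectations under \<open>P\<close> become conditional expectations under \<open>Q\<close> after multiplication with
  the likelihood ratio. The version \<open>Y\<close> has to be bounded everywhere, because a statement that holds
  \<open>P\<close>-almost everywhere says nothing about \<open>Y\<close> where \<open>f\<close> vanishes.
\<close>

lemma bayes:
  assumes U: "U \<in> borel_measurable Q" "\<And>\<omega>. \<bar>U \<omega>\<bar> \<le> c"
    and Y: "Y \<in> borel_measurable (past M n)" "\<And>\<omega>. \<bar>Y \<omega>\<bar> \<le> c"
    and cond: "AE \<omega> in P. real_cond_exp P (past M n) U \<omega> = Y \<omega>"
  shows "AE \<omega> in Q. real_cond_exp Q (past M n) (\<lambda>\<omega>. f \<omega> * U \<omega>) \<omega> = lik n \<omega> * Y \<omega>"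
proof (rule past.real_cond_exp_charact)
  have YQ [measurable]: "Y \<in> borel_measurable Q" by (rule measurable_from_past[OF Y(1)])
  note [measurable] = U(1)
  have sets_PQ: "sets P = sets Q" by (simp add: P_eq)
  have UP: "U \<in> borel_measurable P" "Y \<in> borel_measurable P"
    using U(1) YQ by (simp_all add: measurable_cong_sets[OF sets_PQ refl])
  have intU: "integrable P U" by (rule P.integrable_boundedI[OF UP(1) U(2)])
  show "integrable Q (\<lambda>\<omega>. f \<omega> * U \<omega>)"
    by (rule mult_bounded_integrable[OF f_integrable U])
  show "integrable Q (\<lambda>\<omega>. lik n \<omega> * Y \<omega>)"
    by (rule mult_bounded_integrable[OF past.real_cond_exp_int(1)[OF f_integrable] YQ Y(2)])
  show "(\<lambda>\<omega>. lik n \<omega> * Y \<omega>) \<in> borel_measurable (past M n)"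
    by (intro borel_measurable_times borel_measurable_cond_exp Y(1))
  fix A assume A: "A \<in> sets (past M n)"
  note [measurable] = sets_from_past[OF A]
  have AP: "A \<in> sets P" by (simp add: sets_PQ)
  have set_P: "(\<integral>\<omega>\<in>A. g \<omega> \<partial>P) = (\<integral>\<omega>. f \<omega> * (indicator A \<omega> * g \<omega>) \<partial>Q)"
    if "g \<in> borel_measurable Q" for g :: "(nat \<Rightarrow> 'a) \<Rightarrow> real"
    unfolding set_lebesgue_integral_def using that by (simp add: integral_P)
  have "(\<integral>\<omega>\<in>A. f \<omega> * U \<omega> \<partial>Q) = (\<integral>\<omega>. f \<omega> * (indicator A \<omega> * U \<omega>) \<partial>Q)"
    unfolding set_lebesgue_integral_def
    by (intro Bochner_Integration.integral_cong refl) simp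
  also have "\<dots> = (\<integral>\<omega>\<in>A. U \<omega> \<partial>P)"
    by (rule set_P[OF U(1), symmetric])
  also have "\<dots> = (\<integral>\<omega>\<in>A. real_cond_exp P (past M n) U \<omega> \<partial>P)"
    by (rule P.past.real_cond_exp_intA[OF intU A])
  also have "\<dots> = (\<integral>\<omega>\<in>A. Y \<omega> \<partial>P)"
    using cond AP UP by (intro set_lebesgue_integral_cong_AE) auto
  also have "\<dots> = (\<integral>\<omega>. (indicator A \<omega> * Y \<omega>) * f \<omega> \<partial>Q)"
    unfolding set_P[OF YQ] by (simp add: mult.commute)
  also have "\<dots> = (\<integral>\<omega>. (indicator A \<omega> * Y \<omega>) * lik n \<omega> \<partial>Q)"
  proof (rule past.real_cond_exp_intg(2)[symmetric])
    have "\<bar>indicator A \<omega> * Y \<omega>\<bar> \<le> c" for \<omega>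
      using Y(2)[of \<omega>] by (auto simp: indicator_def intro: order_trans[OF abs_ge_zero])
    then have "integrable Q (\<lambda>\<omega>. f \<omega> * (indicator A \<omega> * Y \<omega>))"
      by (intro mult_bounded_integrable[OF f_integrable]) auto
    then show "integrable Q (\<lambda>\<omega>. (indicator A \<omega> * Y \<omega>) * f \<omega>)"
      by (simp add: mult.commute)
    show "(\<lambda>\<omega>. indicator A \<omega> * Y \<omega>) \<in> borel_measurable (past M n)"
      using A Y(1) by simp
  qed simp
  also have "\<dots> = (\<integral>\<omega>\<in>A. lik n \<omega> * Y \<omega> \<partial>Q)"
    unfolding set_lebesgue_integral_def
    by (intro Bochner_Integration.integral_cong refl) simp
  finally show "(\<integral>\<omega>\<in>A. f \<omega> * U \<omega> \<partial>Q) = (\<integral>\<omega>\<in>A. lik n \<omega> * Y \<omega> \<partial>Q)" .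
qed

lemma cond_exp_W_P:
  assumes cid: "cid M P" and B: "B \<in> sets M"
  shows "AE \<omega> in P. real_cond_exp P (past M n) (W n B) \<omega>
    = sqrt (real n) * (empirical n B \<omega> - P.clipped n B \<omega>)"
  by (intro P.cond_exp_W B P.clipped_measurable_past P.integrable_clipped
      P.cond_exp_hit_clipped cid AE_P[OF AE_convergent_empirical])

definition sup_W :: "'a set set \<Rightarrow> nat \<Rightarrow> (nat \<Rightarrow> 'a) \<Rightarrow> real" where
  "sup_W D n \<omega> = real_sup_norm D (\<lambda>B. W n B \<omega>)"

lemma sup_W_le: "\<bar>sup_W D n \<omega>\<bar> \<le> sqrt (real n)"
  by (simp add: sup_W_def real_sup_norm_nonneg real_sup_norm_le W_abs_le)

text \<open>
  The upper bound from the inequality between the arithmetic and the geometric mean for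
  \<open>\<surd>n \<bar>f - f\<^sub>n\<bar> \<parallel>W\<^sub>n\<parallel>\<close>, an expression that bounds the contribution of all sets \<open>B\<close> at once.
\<close>

definition envelope :: "'a set set \<Rightarrow> nat \<Rightarrow> (nat \<Rightarrow> 'a) \<Rightarrow> real" where
  "envelope D n \<omega> = (real n * (f \<omega> - lik n \<omega>)\<^sup>2 + (sup_W D n \<omega>)\<^sup>2) / 2"

context
  fixes D :: "'a set set"
  assumes D: "countable D" "D \<subseteq> sets M"
begin

lemma measurable_sup_W [measurable]: "sup_W D n \<in> borel_measurable Q"
  unfolding sup_W_def[abs_def] real_sup_norm_def using D
  by (intro measurable_compose[OF measurable_sup_norm] borel_measurable_enn2real measurable_ident
      measurable_W) auto

lemma integrable_sup_W_square: "integrable Q (\<lambda>\<omega>. (sup_W D n \<omega>)\<^sup>2)"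
proof (rule integrable_boundedI)
  show "\<bar>(sup_W D n \<omega>)\<^sup>2\<bar> \<le> real n" for \<omega>
    using power_mono[OF sup_W_le[of D n \<omega>] abs_ge_zero, of 2] by simp
qed simp

lemma integrable_envelope: "integrable Q (envelope D n)"
  unfolding envelope_def[abs_def]
  by (intro integrable_divide Bochner_Integration.integrable_add integrable_mult_right
      lik_error_integrable integrable_sup_W_square)

text \<open>
  Splitting \<open>f = (f - f\<^sub>n) + f\<^sub>n\<close> in the Bayes formula: the first part is controlled by the envelope, the
  second by the bound for \<open>Q\<close>.
\<close>

lemma lik_gap_le:
  assumes cid: "cid M P" and B: "B \<in> D" and n: "1 \<le> n"
  shows "AE \<omega> in Q. lik n \<omega> * \<bar>P.gap n B \<omega>\<bar>
    \<le> real_cond_exp Q (past M n) (envelope D n) \<omega> + \<alpha> * lik n \<omega>"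
proof -
  let ?E = "real_cond_exp Q (past M n)" and ?s = "sqrt (real n)"
  let ?e = "\<lambda>\<omega>. (f \<omega> - lik n \<omega>) * W n B \<omega>"
  have BM [measurable]: "B \<in> sets M" using B D by blast
  note lik_integrable = past.real_cond_exp_int(1)[OF f_integrable, of n]
  note W_int = mult_bounded_integrable[OF _ measurable_W[OF BM] W_abs_le]
  have e_int: "integrable Q ?e"
    by (intro W_int Bochner_Integration.integrable_diff f_integrable lik_integrable)
  have e_le: "\<bar>?s * ?e \<omega>\<bar> \<le> envelope D n \<omega>" for \<omega>
  proof -
    have "\<bar>W n B \<omega>\<bar> \<le> sup_W D n \<omega>"
      unfolding sup_W_def by (rule abs_le_real_sup_norm[OF W_abs_le B])
    then have "(W n B \<omega>)\<^sup>2 \<le> (sup_W D n \<omega>)\<^sup>2"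
      by (metis abs_ge_zero power2_abs power_mono)
    moreover have "2 * \<bar>?s * (f \<omega> - lik n \<omega>)\<bar> * \<bar>W n B \<omega>\<bar>
        \<le> \<bar>?s * (f \<omega> - lik n \<omega>)\<bar>\<^sup>2 + \<bar>W n B \<omega>\<bar>\<^sup>2"
      by (rule sum_squares_bound)
    then have "2 * \<bar>?s * ?e \<omega>\<bar> \<le> real n * (f \<omega> - lik n \<omega>)\<^sup>2 + (W n B \<omega>)\<^sup>2"
      by (simp add: power_mult_distrib abs_mult mult.assoc)
    ultimately show ?thesis by (simp add: envelope_def)
  qed
  have gap_bounded: "\<bar>?s * (empirical n B \<omega> - P.clipped n B \<omega>)\<bar> \<le> ?s" for \<omega>
  proof -
    have "\<bar>empirical n B \<omega> - P.clipped n B \<omega>\<bar> \<le> 1"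
      using empirical_nonneg[of n B \<omega>] empirical_le_1[of n B \<omega>] P.clipped_bounds[of n B \<omega>]
      by linarith
    then show ?thesis
      unfolding abs_mult using mult_left_mono[of _ 1 ?s] by simp
  qed
  have "AE \<omega> in Q. ?E (\<lambda>\<omega>. f \<omega> * W n B \<omega>) \<omega> = lik n \<omega> * (?s * (empirical n B \<omega> - P.clipped n B \<omega>))"
    by (rule bayes[OF measurable_W[OF BM] W_abs_le _ gap_bounded cond_exp_W_P[OF cid BM]])
       (intro borel_measurable_times borel_measurable_diff borel_measurable_const
         empirical_measurable_past[OF BM] P.clipped_measurable_past)
  moreover have "AE \<omega> in Q. ?E (\<lambda>\<omega>. f \<omega> * W n B \<omega>) \<omega> = ?E ?e \<omega> + ?E (\<lambda>\<omega>. lik n \<omega> * W n B \<omega>) \<omega>"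
  proof -
    have split: "(\<lambda>\<omega>. f \<omega> * W n B \<omega>) = (\<lambda>\<omega>. ?e \<omega> + lik n \<omega> * W n B \<omega>)"
      by (simp add: algebra_simps)
    show ?thesis
      unfolding split by (intro past.real_cond_exp_add e_int W_int lik_integrable)
  qed
  moreover have "AE \<omega> in Q. ?E (\<lambda>\<omega>. lik n \<omega> * W n B \<omega>) \<omega> = lik n \<omega> * ?E (W n B) \<omega>"
    by (intro past.real_cond_exp_mult borel_measurable_cond_exp measurable_W BM W_int lik_integrable)
  moreover have "AE \<omega> in Q. ?E (\<lambda>\<omega>. ?s * ?e \<omega>) \<omega> \<le> ?E (envelope D n) \<omega>"
    using e_le by (intro past.real_cond_exp_mono integrable_mult_right e_int integrable_envelope)
      (auto simp: abs_le_iff)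
  moreover have "AE \<omega> in Q. ?E (\<lambda>\<omega>. (- ?s) * ?e \<omega>) \<omega> \<le> ?E (envelope D n) \<omega>"
    using e_le by (intro past.real_cond_exp_mono integrable_mult_right e_int integrable_envelope)
      (auto simp: abs_le_iff)
  moreover have "AE \<omega> in Q. ?E (\<lambda>\<omega>. ?s * ?e \<omega>) \<omega> = ?s * ?E ?e \<omega>"
    by (intro past.real_cond_exp_cmult e_int)
  moreover have "AE \<omega> in Q. ?E (\<lambda>\<omega>. (- ?s) * ?e \<omega>) \<omega> = (- ?s) * ?E ?e \<omega>"
    by (intro past.real_cond_exp_cmult e_int)
  moreover note lik_nonneg[of n] cond_exp_W_bound[OF BM n]
  ultimately show ?thesis
  proof eventually_elim
    case (elim \<omega>)
    have "P.gap n B \<omega> = ?s * (?s * (empirical n B \<omega> - P.clipped n B \<omega>))"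
      by (simp add: P.gap_def mult.assoc[symmetric])
    moreover have "lik n \<omega> * (?s * (empirical n B \<omega> - P.clipped n B \<omega>)) = ?E ?e \<omega> + lik n \<omega> * ?E (W n B) \<omega>"
      using elim(1-3) by simp
    moreover have "l * a = s * e + l * (s * w)" if "a = s * (s * x)" "l * (s * x) = e + l * w"
      for a e l s w x :: real
    proof -
      have "l * a = s * (l * (s * x))" unfolding that(1) by (rule mult.left_commute)
      also have "\<dots> = s * e + l * (s * w)" unfolding that(2) distrib_left mult.left_commute[of s l] ..
      finally show ?thesis .
    qed
    ultimately have "lik n \<omega> * P.gap n B \<omega> = ?s * ?E ?e \<omega> + lik n \<omega> * (?s * ?E (W n B) \<omega>)"
      by blast
    moreover have "\<bar>?s * ?E ?e \<omega>\<bar> \<le> ?E (envelope D n) \<omega>"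
      using elim by (simp add: abs_le_iff)
    moreover have "\<bar>lik n \<omega> * (?s * ?E (W n B) \<omega>)\<bar> \<le> lik n \<omega> * \<alpha>"
      using elim by (simp add: abs_mult mult_left_mono)
    moreover have "lik n \<omega> * \<bar>P.gap n B \<omega>\<bar> = \<bar>lik n \<omega> * P.gap n B \<omega>\<bar>"
      using elim by (simp add: abs_mult)
    moreover have "lik n \<omega> * \<alpha> = \<alpha> * lik n \<omega>"
      by (rule mult.commute)
    ultimately show ?case by linarith
  qed
qed

text \<open>
  The supremum over \<open>B\<close> depends on the past only, so under the integral the density \<open>f\<close> may be replaced
  by the likelihood ratio; then the pointwise estimate applies.
\<close>

lemma expectation_sup_gap_le:
  assumes cid: "cid M P" and n: "1 \<le> n"
  shows "(\<integral>\<omega>. P.sup_gap D n \<omega> \<partial>P)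
    \<le> (real n * ((\<integral>\<omega>. (f \<omega>)\<^sup>2 \<partial>Q) - (\<integral>\<omega>. (lik n \<omega>)\<^sup>2 \<partial>Q)) + (\<integral>\<omega>. (sup_W D n \<omega>)\<^sup>2 \<partial>Q)) / 2 + \<alpha>"
proof -
  let ?E = "real_cond_exp Q (past M n)"
  let ?R = "P.sup_gap D n"
  note R_past = P.sup_gap_measurable_past[OF D, of n]
  note R_Q [measurable] = measurable_from_past[OF R_past]
  have R_le: "\<bar>?R \<omega>\<bar> \<le> real n" for \<omega>
    by (simp add: P.sup_gap_nonneg P.sup_gap_le)
  note lik_integrable = past.real_cond_exp_int(1)[OF f_integrable, of n]
  have "AE \<omega> in Q. \<forall>B\<in>D. lik n \<omega> * \<bar>P.gap n B \<omega>\<bar> \<le> ?E (envelope D n) \<omega> + \<alpha> * lik n \<omega>"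
    using D lik_gap_le[OF cid _ n] by (simp add: AE_ball_countable)
  moreover have "AE \<omega> in Q. 0 \<le> ?E (envelope D n) \<omega>"
    using integrable_envelope[of n] by (intro past.real_cond_exp_pos) (auto simp: envelope_def)
  moreover note lik_nonneg[of n]
  ultimately have le: "AE \<omega> in Q. lik n \<omega> * ?R \<omega> \<le> ?E (envelope D n) \<omega> + \<alpha> * lik n \<omega>"
  proof eventually_elim
    case (elim \<omega>)
    \<comment> \<open>the estimate for each \<open>B\<close> passes to the supremum after division by the likelihood ratio\<close>
    show ?case
    proof (cases "lik n \<omega> = 0")
      case True
      with elim show ?thesis by simp
    next
      case False
      with elim have pos: "0 < lik n \<omega>" by simp
      have "?R \<omega> \<le> (?E (envelope D n) \<omega> + \<alpha> * lik n \<omega>) / lik n \<omega>"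
        unfolding P.sup_gap_def using elim pos \<alpha>_pos
        by (intro real_sup_norm_le) (auto simp: pos_le_divide_eq mult.commute)
      with pos show ?thesis by (simp add: pos_le_divide_eq mult.commute)
    qed
  qed
  have "(\<integral>\<omega>. ?R \<omega> \<partial>P) = (\<integral>\<omega>. ?R \<omega> * f \<omega> \<partial>Q)"
    unfolding integral_P[OF R_Q] by (simp add: mult.commute)
  also have "\<dots> = (\<integral>\<omega>. ?R \<omega> * lik n \<omega> \<partial>Q)"
    using mult_bounded_integrable[OF f_integrable R_Q R_le] R_past
    by (intro past.real_cond_exp_intg(2)[symmetric]) (auto simp: mult.commute)
  also have "\<dots> \<le> (\<integral>\<omega>. ?E (envelope D n) \<omega> + \<alpha> * lik n \<omega> \<partial>Q)"
  proof (rule integral_mono_AE)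
    show "integrable Q (\<lambda>\<omega>. ?R \<omega> * lik n \<omega>)"
      using mult_bounded_integrable[OF lik_integrable R_Q R_le] by (simp add: mult.commute)
    show "integrable Q (\<lambda>\<omega>. ?E (envelope D n) \<omega> + \<alpha> * lik n \<omega>)"
      by (intro Bochner_Integration.integrable_add integrable_mult_right lik_integrable
          past.real_cond_exp_int(1) integrable_envelope)
    show "AE \<omega> in Q. ?R \<omega> * lik n \<omega> \<le> ?E (envelope D n) \<omega> + \<alpha> * lik n \<omega>"
      using le by (simp add: mult.commute)
  qed
  also have "\<dots> = (\<integral>\<omega>. envelope D n \<omega> \<partial>Q) + \<alpha>"
    using past.real_cond_exp_int[OF integrable_envelope, of n n] past.real_cond_exp_int[OF f_integrable, of n]
    by (simp add: integral_f)
  also have "(\<integral>\<omega>. envelope D n \<omega> \<partial>Q)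
      = (real n * (\<integral>\<omega>. (f \<omega> - lik n \<omega>)\<^sup>2 \<partial>Q) + (\<integral>\<omega>. (sup_W D n \<omega>)\<^sup>2 \<partial>Q)) / 2"
    unfolding envelope_def using lik_error_integrable[of n] integrable_sup_W_square[of n] by simp
  finally show ?thesis by (simp add: lik_pythagoras)
qed

end

end

section \<open>Convergence of the normalised prediction error\<close>

theorem theorem2:
  fixes M :: "'a measure"
    and P Q0 :: "(nat \<Rightarrow> 'a) measure"
    and D D0 :: "'a set set"
    and f :: "(nat \<Rightarrow> 'a) \<Rightarrow> real"
  assumes "prob_space P" and "sets P = sets (seq_space M)"
    and "cid M P"
    and "ferguson_dirichlet M Q0"
    and "D \<subseteq> sets M" and "countably_determined_by M D D0"
    and "(SUP n\<in>{1..}. \<integral>\<^sup>+\<omega>. (sup_norm D0 (\<lambda>B. W n B \<omega>))\<^sup>2 \<partial>Q0) < \<infinity>"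
    and "absolutely_continuous Q0 P"
    and "f \<in> borel_measurable Q0"
    and "AE \<omega> in Q0. f \<omega> = enn2real (RN_deriv Q0 P \<omega>)"
    and "integrable Q0 (\<lambda>\<omega>. (f \<omega>)\<^sup>2)"
    and "(\<lambda>n. (\<integral>\<omega>. (f \<omega>)\<^sup>2 \<partial>Q0) - (\<integral>\<omega>. (real_cond_exp Q0 (past M n) f \<omega>)\<^sup>2 \<partial>Q0))
           \<in> O(\<lambda>n. 1 / real n)"
  shows "AE \<omega> in P.
    (\<forall>n. ennreal (sqrt (real n)) * sup_norm D0 (\<lambda>B. C M P n B \<omega>)
       = ennreal (real n) * sup_norm D0 (\<lambda>B. empirical n B \<omega> - predictive M P n B \<omega>)) \<and>
    (\<exists>l<\<infinity>. (\<lambda>n. ennreal (sqrt (real n)) * sup_norm D0 (\<lambda>B. C M P n B \<omega>)) \<longlonglongrightarrow> l)"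
proof -
  note cid = assms(3)
  obtain \<alpha> where \<alpha>: "0 < \<alpha>"
    and pred: "\<forall>B\<in>sets M. \<forall>n\<ge>1. AE \<omega> in Q0. predictive M Q0 n B \<omega>
        = (\<alpha> * measure Q0 {\<omega> \<in> space Q0. \<omega> 0 \<in> B} + real n * empirical n B \<omega>) / (\<alpha> + real n)"
    and Q0: "prob_space Q0" "sets Q0 = sets (seq_space M)"
    using assms(4) unfolding ferguson_dirichlet_def by blast
  have D0: "countable D0" "D0 \<subseteq> sets M"
    using assms(5,6) by (auto simp: countably_determined_by_def)
  interpret P: coordinate_process M P
    using assms(1,2) by (simp add: coordinate_process_def coordinate_process_axioms_def)
  interpret Q: ferguson_dirichlet_process M Q0 \<alpha>
    using Q0 \<alpha> pred
    by (simp add: ferguson_dirichlet_process_def ferguson_dirichlet_process_axioms_def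
        coordinate_process_def coordinate_process_axioms_def)
  have sets_eq: "sets P = sets Q0"
    using assms(2) Q0 by simp
  have RN: "AE \<omega> in Q0. RN_deriv Q0 P \<omega> \<noteq> \<infinity>"
    by (rule Q.RN_deriv_finite[OF P.sigma_finite_measure_axioms assms(8) sets_eq])
  have f_RN: "AE \<omega> in Q0. RN_deriv Q0 P \<omega> = ennreal (f \<omega>)"
    using RN assms(10) by eventually_elim (simp add: less_top)
  have P_eq: "P = density Q0 (\<lambda>\<omega>. ennreal (f \<omega>))"
  proof -
    have "P = density Q0 (RN_deriv Q0 P)"
      by (rule Q.density_RN_deriv[OF assms(8) sets_eq, symmetric])
    also have "\<dots> = density Q0 (\<lambda>\<omega>. ennreal (f \<omega>))"
      using assms(9) by (intro density_cong f_RN) auto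
    finally show ?thesis .
  qed
  interpret ferguson_dirichlet_density M Q0 \<alpha> P f
  proof
    show "AE \<omega> in Q0. 0 \<le> f \<omega>"
      using assms(10) by eventually_elim simp
  qed (fact assms P_eq)+
  let ?R = "P.sup_gap D0"
  obtain K where K: "\<And>n. 1 \<le> n \<Longrightarrow> (\<integral>\<omega>. (sup_W D0 n \<omega>)\<^sup>2 \<partial>Q0) \<le> K"
  proof -
    \<comment> \<open>the integrals are finite because the norms are at most \<open>\<surd>n\<close>, so they agree with the extended ones\<close>
    define S where "S = (SUP n\<in>{1..}. \<integral>\<^sup>+\<omega>. (sup_norm D0 (\<lambda>B. W n B \<omega>))\<^sup>2 \<partial>Q0)"
    have "(\<integral>\<omega>. (sup_W D0 n \<omega>)\<^sup>2 \<partial>Q0) \<le> enn2real S" if "1 \<le> n" for n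
    proof -
      have "ennreal (\<integral>\<omega>. (sup_W D0 n \<omega>)\<^sup>2 \<partial>Q0) = (\<integral>\<^sup>+\<omega>. ennreal ((sup_W D0 n \<omega>)\<^sup>2) \<partial>Q0)"
        using integrable_sup_W_square[OF D0] by (intro nn_integral_eq_integral[symmetric]) auto
      also have "\<dots> = (\<integral>\<^sup>+\<omega>. (sup_norm D0 (\<lambda>B. W n B \<omega>))\<^sup>2 \<partial>Q0)"
        unfolding sup_W_def
        by (simp add: ennreal_power[symmetric] real_sup_norm_nonneg
            ennreal_real_sup_norm[of D0 "\<lambda>B. W n B _", OF W_abs_le])
      also have "\<dots> \<le> S"
        unfolding S_def using that by (intro SUP_upper) simp
      finally have "ennreal (\<integral>\<omega>. (sup_W D0 n \<omega>)\<^sup>2 \<partial>Q0) \<le> S" .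
      then show ?thesis
        using assms(7) unfolding S_def[symmetric]
        by (cases S) simp_all
    qed
    then show thesis by (rule that)
  qed
  obtain c N where cN: "\<And>n. N \<le> n \<Longrightarrow>
      real n * ((\<integral>\<omega>. (f \<omega>)\<^sup>2 \<partial>Q0) - (\<integral>\<omega>. (lik n \<omega>)\<^sup>2 \<partial>Q0)) \<le> c"
  proof -
    obtain c where "eventually (\<lambda>n. norm ((\<integral>\<omega>. (f \<omega>)\<^sup>2 \<partial>Q0) - (\<integral>\<omega>. (lik n \<omega>)\<^sup>2 \<partial>Q0))
        \<le> c * norm (1 / real n)) sequentially"
      using assms(12) by (auto elim: landau_o.bigE)
    then obtain N where N: "\<And>n. N \<le> n \<Longrightarrow> \<bar>(\<integral>\<omega>. (f \<omega>)\<^sup>2 \<partial>Q0) - (\<integral>\<omega>. (lik n \<omega>)\<^sup>2 \<partial>Q0)\<bar> \<le> c * (1 / real n)"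
      unfolding eventually_sequentially by auto
    have "real n * ((\<integral>\<omega>. (f \<omega>)\<^sup>2 \<partial>Q0) - (\<integral>\<omega>. (lik n \<omega>)\<^sup>2 \<partial>Q0)) \<le> c" if "max 1 N \<le> n" for n
    proof -
      have "real n * ((\<integral>\<omega>. (f \<omega>)\<^sup>2 \<partial>Q0) - (\<integral>\<omega>. (lik n \<omega>)\<^sup>2 \<partial>Q0)) \<le> real n * (c * (1 / real n))"
        using N[of n] that by (intro mult_left_mono) auto
      then show ?thesis using that by simp
    qed
    then show thesis by (rule that)
  qed
  \<comment> \<open>the estimate starts at some index, and below it the trivial bound \<open>n\<close> is good enough\<close>
  define K' where "K' = max (real (max 1 N)) ((c + K) / 2 + \<alpha>)"
  have bound: "(\<integral>\<omega>. ?R n \<omega> \<partial>P) \<le> K'" for n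
  proof (cases "max 1 N \<le> n")
    case True
    then have n: "1 \<le> n" "N \<le> n" by simp_all
    have "(\<integral>\<omega>. ?R n \<omega> \<partial>P) \<le> (c + K) / 2 + \<alpha>"
      using expectation_sup_gap_le[OF D0 cid n(1)] cN[OF n(2)] K[OF n(1)] by argo
    then show ?thesis by (simp add: K'_def)
  next
    case False
    have "(\<integral>\<omega>. ?R n \<omega> \<partial>P) \<le> real n"
      by (rule P.integral_le_const[OF P.integrable_sup_gap[OF D0]]) (simp add: P.sup_gap_le)
    also have "real n \<le> real (max 1 N)"
      using less_imp_le[OF not_le_imp_less[OF False]] by (rule of_nat_mono)
    also have "\<dots> \<le> K'"
      by (simp add: K'_def)
    finally show ?thesis .
  qed
  interpret R: bounded_submartingale P "past M" ?R K'
    by (rule P.sup_gap_submartingale[OF cid D0 bound])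
  have "AE \<omega> in P. \<forall>n. \<forall>B\<in>D0. C M P n B \<omega> = sqrt (real n) * (empirical n B \<omega> - P.clipped n B \<omega>)"
    unfolding C_def AE_all_countable using D0
    by (auto simp: AE_ball_countable intro!: cond_exp_W_P[OF cid])
  moreover have "AE \<omega> in P. \<forall>n. \<forall>B\<in>D0. predictive M P n B \<omega> = P.clipped n B \<omega>"
    unfolding AE_all_countable using D0
    by (auto simp: AE_ball_countable intro!: P.AE_clipped)
  ultimately show ?thesis using R.AE_convergent
  proof eventually_elim
    case (elim \<omega>)
    have C: "ennreal (sqrt (real n)) * sup_norm D0 (\<lambda>B. C M P n B \<omega>) = ennreal (?R n \<omega>)" for n
    proof -
      have "ennreal (sqrt (real n)) * sup_norm D0 (\<lambda>B. C M P n B \<omega>) = sup_norm D0 (\<lambda>B. P.gap n B \<omega>)"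
        unfolding sup_norm_cmult[OF real_sqrt_ge_zero[OF of_nat_0_le_iff], symmetric]
        using elim(1) by (intro sup_norm_cong) (simp add: P.gap_def mult.assoc[symmetric])
      also have "\<dots> = ennreal (?R n \<omega>)"
        unfolding P.sup_gap_def
        by (rule ennreal_real_sup_norm[symmetric, of D0 "\<lambda>B. P.gap n B \<omega>" "real n"]) (rule P.gap_abs_le)
      finally show ?thesis .
    qed
    have "ennreal (real n) * sup_norm D0 (\<lambda>B. empirical n B \<omega> - predictive M P n B \<omega>) = ennreal (?R n \<omega>)" for n
    proof -
      have "ennreal (real n) * sup_norm D0 (\<lambda>B. empirical n B \<omega> - predictive M P n B \<omega>)
          = sup_norm D0 (\<lambda>B. P.gap n B \<omega>)"
        unfolding sup_norm_cmult[OF of_nat_0_le_iff, symmetric]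
        using elim(2) by (intro sup_norm_cong) (simp add: P.gap_def)
      also have "\<dots> = ennreal (?R n \<omega>)"
        unfolding P.sup_gap_def
        by (rule ennreal_real_sup_norm[symmetric, of D0 "\<lambda>B. P.gap n B \<omega>" "real n"]) (rule P.gap_abs_le)
      finally show ?thesis .
    qed
    with C elim(3) show ?case by simp
  qed
qed

end
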